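(* Let $k \ge 3$ be a fixed integer. For each positive integer $n$ let $X$ be the number of monochromatic $K_k$'s in a uniformly random red/blue edge-coloring of $K_n$, and let $\mu = E[X]$. For fixed $k$, regard the central moments of $X$ as polynomials in $n$. Then: (1) the leading term of $E[(X-\mu)^2]$ is $$\frac{1}{2}\cdot\frac{1}{((k-3)!)^2}\cdot\frac{n^{2k-3}}{2^{2\binom{k}{2}-2}};$$ (2) the leading term of $E[(X-\mu)^3]$ is $$\frac{1}{((k-3)!)^3}\cdot\frac{n^{3k-5}}{2^{3\binom{k}{2}-3}};$$ (3) the leading term of $E[(X-\mu)^4]$ is $$\frac{3}{4}\cdot\frac{1}{((k-3)!)^4}\cdot\frac{n^{4k-6}}{2^{4\binom{k}{2}-4}};$$ (4) the leading term of $E[(X-\mu)^5]$ is $$5\cdot\frac{1}{((k-3)!)^5}\cdot\frac{n^{5k-8}}{2^{5\binom{k}{2}-5}}.$$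
   Context: Each edge of the complete graph $K_n$ on vertex set $\{1,\dots,n\}$ is colored red or blue, independently and with probability $1/2$ each (equivalently, all $2^{\binom n2}$ colorings are equally likely). For a $k$-subset $S$ of $\{1,\dots,n\}$, $X_S$ is the indicator that all edges of the subgraph induced by $S$ have the same color, and $X = \sum_S X_S$, the sum being over all $k$-subsets $S$. "Leading term" means the term of highest degree in $n$ of the polynomial in $n$ (with $k$ fixed) that gives the moment. *)

theory Defs
  imports "HOL-Probability.Probability" "HOL-Library.Ramsey"
    "HOL-Computational_Algebra.Polynomial"
begin

datatype colour = Red | Blue

(* The edges of K_n are the two-element subsets of {1..n}. *)
definition colorings :: "nat \<Rightarrow> (nat set \<Rightarrow> colour) set" where
  "colorings n = (\<Pi>\<^sub>E e \<in> nsets {1..n} 2. UNIV)"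

definition random_coloring :: "nat \<Rightarrow> (nat set \<Rightarrow> colour) pmf" where
  "random_coloring n = pmf_of_set (colorings n)"

definition monochromatic :: "(nat set \<Rightarrow> colour) \<Rightarrow> nat set \<Rightarrow> bool" where
  "monochromatic c S \<longleftrightarrow> (\<exists>q. \<forall>e \<in> nsets S 2. c e = q)"

definition num_mono :: "nat \<Rightarrow> nat \<Rightarrow> (nat set \<Rightarrow> colour) \<Rightarrow> real" where
  "num_mono k n c = (\<Sum>S \<in> nsets {1..n} k. of_bool (monochromatic c S))"

definition mean_mono :: "nat \<Rightarrow> nat \<Rightarrow> real" where
  "mean_mono k n = measure_pmf.expectation (random_coloring n) (num_mono k n)"

definition central_moment :: "nat \<Rightarrow> nat \<Rightarrow> nat \<Rightarrow> real" where
  "central_moment r k n =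
     measure_pmf.expectation (random_coloring n) (\<lambda>c. (num_mono k n c - mean_mono k n) ^ r)"

(* f agrees at every positive integer with a polynomial, necessarily unique,
   whose term of highest degree is a * n ^ d. *)
definition has_leading_term :: "(nat \<Rightarrow> real) \<Rightarrow> real \<Rightarrow> nat \<Rightarrow> bool" where
  "has_leading_term f a d \<longleftrightarrow>
     (\<exists>p :: real poly. (\<forall>n\<ge>1. f n = poly p (real n)) \<and> degree p = d \<and> lead_coeff p = a)"

end

theory Submission imports Defs begin

text \<open>
  Encode the colours as the signs \<open>1\<close> and \<open>-1\<close>. On a clique \<open>S\<close> the indicator of being monochromatic is
  then \<open>2 / 2 ^ (k choose 2)\<close> times the sum of all characters (products of signs) over edge sets
  \<open>F\<close> of \<open>S\<close> of even size, and subtracting the mean removes exactly the term of the empty \<open>F\<close>.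
  A product of characters has expectation \<open>1\<close> if every edge is used an even number of times, and
  \<open>0\<close> otherwise. So, up to the factor \<open>(2 / 2 ^ (k choose 2)) ^ r\<close>, the \<open>r\<close>-th central moment
  counts, for all \<open>r\<close>-tuples of cliques \<open>S\<close>, the families of nonempty even edge sets
  \<open>F i\<close> of \<open>S i\<close> that cancel in this sense. Sorting the tuples by the vertex set
  \<open>V\<close> that they cover gives \<open>\<Sum>v. (n choose v) * weight v\<close>, a polynomial in \<open>n\<close>; its leading
  coefficient is \<open>weight d / fact d\<close> for the largest \<open>d\<close> with nonzero weight.

  It remains to find the tuples that cover as many vertices as possible. Every edge that a
  cancelling family uses lies in at least two of the cliques, and every \<open>F i\<close> has two edges, so each clique has at
  least three shared vertices, each of them in at least two cliques. Double counting turns this into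
  an identity (\<open>excess_identity\<close>) saying that \<open>2 r k - 3 r - 2 |V|\<close> is a sum of nonnegative
  local surpluses: shared vertices of a clique beyond the third, and cliques at a shared vertex
  beyond the second. In the four extremal cases this total surplus is \<open>0, 1, 0, 1\<close>.

  A clique without surplus, in itself and at its shared vertices, has a partner that contains all
  these vertices (\<open>partner\<close>). For two
  cliques the extremal tuples therefore share a triangle, which carries three nonempty even edge sets. For three
  cliques they form a star: one vertex common to all three cliques, and one further vertex in each
  intersection of two, with exactly one cancelling family. For four and five cliques a pair of
  partners splits off without sharing vertices with the others, and the weight is multiplicative
  over such a splitting: four cliques are two independent pairs in \<open>3\<close> possible ways, five
  cliques are a pair and a star in \<open>10\<close> possible ways.
\<close>

section \<open>Moments as sums over cancelling families of edge sets\<close>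

fun spin :: "colour \<Rightarrow> real" where
  "spin Red = 1"
| "spin Blue = - 1"

definition character :: "nat set set \<Rightarrow> (nat set \<Rightarrow> colour) \<Rightarrow> real" where
  "character F c = (\<Prod>e\<in>F. spin (c e))"

lemma UNIV_colour: "UNIV = {Red, Blue}"
  by (auto intro: colour.exhaust)

lemma finite_colour: "finite (UNIV :: colour set)"
  by (simp add: UNIV_colour)

lemma finite_colorings: "finite (colorings n)"
  unfolding colorings_def
  by (intro finite_PiE finite_imp_finite_nsets finite_colour) auto

lemma colorings_nonempty: "colorings n \<noteq> {}"
  by (auto simp: colorings_def PiE_eq_empty_iff)

lemma card_colorings: "card (colorings n) = 2 ^ card (nsets {1..n} 2)"
  unfolding colorings_def
  by (subst card_PiE) (auto simp: finite_imp_finite_nsets UNIV_colour numeral_2_eq_2)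

lemma expectation_coloring:
  "measure_pmf.expectation (random_coloring n) f = sum f (colorings n) / 2 ^ card (nsets {1..n} 2)"
  for f :: "_ \<Rightarrow> real"
  unfolding random_coloring_def
  by (simp add: integral_pmf_of_set finite_colorings colorings_nonempty card_colorings)

lemma prod_character_eq:
  assumes "finite I" "finite E" "\<And>i. i \<in> I \<Longrightarrow> F i \<subseteq> E"
  shows "(\<Prod>i\<in>I. character (F i) c) = (\<Prod>e\<in>E. spin (c e) ^ card {i \<in> I. e \<in> F i})"
proof -
  have "character (F i) c = (\<Prod>e\<in>E. if e \<in> F i then spin (c e) else 1)" if "i \<in> I" for i
  proof -
    have "{e \<in> E. e \<in> F i} = F i" using assms(3)[OF that] by blast
    then show ?thesis
      unfolding character_def using assms(2) by (simp add: prod.inter_filter[symmetric])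
  qed
  then have "(\<Prod>i\<in>I. character (F i) c) = (\<Prod>i\<in>I. \<Prod>e\<in>E. if e \<in> F i then spin (c e) else 1)"
    by simp
  also have "\<dots> = (\<Prod>e\<in>E. \<Prod>i\<in>I. if e \<in> F i then spin (c e) else 1)"
    by (rule prod.swap)
  also have "\<dots> = (\<Prod>e\<in>E. spin (c e) ^ card {i \<in> I. e \<in> F i})"
    using assms(1) by (intro prod.cong) (simp_all add: prod.inter_filter[symmetric])
  finally show ?thesis .
qed

text \<open>
  The expectation factors over the edges, and the sign of an edge averages to \<open>0\<close> when raised
  to an odd power and to \<open>1\<close> when raised to an even one.
\<close>

lemma expectation_prod_character:
  assumes "finite I" and sub: "\<And>i. i \<in> I \<Longrightarrow> F i \<subseteq> nsets {1..n} 2"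
  shows "measure_pmf.expectation (random_coloring n) (\<lambda>c. \<Prod>i\<in>I. character (F i) c)
           = of_bool (\<forall>e. even (card {i \<in> I. e \<in> F i}))"
proof -
  let ?E = "nsets {1..n} 2" and ?m = "\<lambda>e. card {i \<in> I. e \<in> F i}"
  have fin: "finite ?E" by (simp add: finite_imp_finite_nsets)
  have "(\<Sum>c\<in>colorings n. \<Prod>i\<in>I. character (F i) c) = (\<Sum>c\<in>colorings n. \<Prod>e\<in>?E. spin (c e) ^ ?m e)"
    using prod_character_eq[OF assms(1) fin sub] by simp
  also have "\<dots> = (\<Prod>e\<in>?E. \<Sum>q\<in>UNIV. spin q ^ ?m e)"
    unfolding colorings_def
    by (rule prod_sum_PiE[symmetric]) (use fin finite_colour in auto)
  also have "\<dots> = (\<Prod>e\<in>?E. 2 * of_bool (even (?m e)))"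
    by (intro prod.cong) (auto simp: UNIV_colour minus_one_power_iff)
  also have "\<dots> = 2 ^ card ?E * of_bool (\<forall>e\<in>?E. even (?m e))"
    using fin by (auto simp: prod.distrib)
  also have "(\<forall>e\<in>?E. even (?m e)) \<longleftrightarrow> (\<forall>e. even (?m e))"
  proof -
    have "?m e = 0" if "e \<notin> ?E" for e
      using that sub by (auto intro!: card_eq_0_iff[THEN iffD2])
    then show ?thesis by (metis even_zero)
  qed
  finally show ?thesis by (simp add: expectation_coloring)
qed

text \<open>
  The empty edge set is excluded because its character is the constant that centring removes.
\<close>

definition even_edge_sets :: "'a set \<Rightarrow> 'a set set set" where
  "even_edge_sets S = {F. F \<subseteq> nsets S 2 \<and> F \<noteq> {} \<and> even (card F)}"

lemma finite_even_edge_sets: "finite S \<Longrightarrow> finite (even_edge_sets S)"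
  unfolding even_edge_sets_def
  by (rule finite_subset[of _ "Pow (nsets S 2)"]) (auto simp: finite_imp_finite_nsets)

text \<open>
  The product of \<open>1 + spin (c e)\<close> over the edges detects that all of them are red, the product
  of \<open>1 - spin (c e)\<close> that all are blue. In the sum of the two expansions the characters
  of odd edge sets cancel and those of even edge sets double.
\<close>

lemma of_bool_monochromatic:
  assumes "finite S" "2 \<le> card S"
  shows "of_bool (monochromatic c S)
           = 2 / 2 ^ (card S choose 2) * (1 + (\<Sum>F\<in>even_edge_sets S. character F c))"
proof -
  let ?E = "nsets S 2"
  have fin: "finite ?E" using assms by (simp add: finite_imp_finite_nsets)
  have cE: "card ?E = card S choose 2" by (simp add: card_nsets)
  have ne: "?E \<noteq> {}" using assms by (simp add: nsets_eq_empty_iff)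
  have p: "(\<Prod>e\<in>?E. 1 + t * spin (c e)) = (\<Sum>F\<in>Pow ?E. t ^ card F * character F c)" for t :: real
    using prod_add[OF fin, of "\<lambda>e. t * spin (c e)" "\<lambda>_. 1"]
    by (simp add: add.commute prod.distrib character_def)
  have all: "(\<Prod>e\<in>?E. 1 + spin q * spin (c e)) = 2 ^ card ?E * of_bool (\<forall>e\<in>?E. c e = q)" for q
  proof -
    have "1 + spin q * spin r = 2 * of_bool (r = q)" for r by (cases q; cases r) auto
    then show ?thesis using fin by (auto simp: prod.distrib)
  qed
  have "2 ^ card ?E * of_bool (monochromatic c S) =
        2 ^ card ?E * (of_bool (\<forall>e\<in>?E. c e = Red) + of_bool (\<forall>e\<in>?E. c e = Blue) :: real)"
  proof -
    have "monochromatic c S \<longleftrightarrow> (\<exists>q\<in>{Red, Blue}. \<forall>e\<in>?E. c e = q)"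
      unfolding monochromatic_def UNIV_colour[symmetric] by simp
    then have "monochromatic c S \<longleftrightarrow> (\<forall>e\<in>?E. c e = Red) \<or> (\<forall>e\<in>?E. c e = Blue)"
      by simp
    moreover have "\<not> ((\<forall>e\<in>?E. c e = Red) \<and> (\<forall>e\<in>?E. c e = Blue))" using ne by auto
    ultimately show ?thesis by auto
  qed
  also have "\<dots> = (\<Sum>F\<in>Pow ?E. (1 + (-1) ^ card F) * character F c)"
    using all[of Red] all[of Blue] p[of 1] p[of "-1"]
    by (simp add: algebra_simps sum.distrib)
  also have "\<dots> = (\<Sum>F\<in>{F \<in> Pow ?E. even (card F)}. 2 * character F c)"
    using fin by (intro sum.mono_neutral_cong_right) auto
  also have "{F \<in> Pow ?E. even (card F)} = insert {} (even_edge_sets S)"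
    by (auto simp: even_edge_sets_def)
  also have "(\<Sum>F\<in>\<dots>. 2 * character F c) = 2 * (1 + (\<Sum>F\<in>even_edge_sets S. character F c))"
    using assms finite_even_edge_sets[of S]
    by (subst sum.insert) (auto simp: even_edge_sets_def character_def sum_distrib_left)
  finally show ?thesis by (simp add: cE field_simps)
qed

text \<open>
  The families whose characters multiply to the constant \<open>1\<close>: the symmetric difference of all
  \<open>F i\<close> is empty.
\<close>

definition cancelling :: "'i set \<Rightarrow> ('i \<Rightarrow> 'a set) \<Rightarrow> ('i \<Rightarrow> 'a set set) set" where
  "cancelling I S = {F \<in> (\<Pi>\<^sub>E i\<in>I. even_edge_sets (S i)). \<forall>e. even (card {i \<in> I. e \<in> F i})}"

lemma finite_cancelling:
  "finite I \<Longrightarrow> (\<And>i. i \<in> I \<Longrightarrow> finite (S i)) \<Longrightarrow> finite (cancelling I S)"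
  unfolding cancelling_def by (simp add: finite_PiE finite_even_edge_sets)

lemma even_edge_sets_subset: "F \<in> even_edge_sets S \<Longrightarrow> S \<subseteq> V \<Longrightarrow> F \<subseteq> nsets V 2"
  unfolding even_edge_sets_def using nsets_mono by blast

lemma expectation_character:
  assumes "F \<in> even_edge_sets S" "S \<subseteq> {1..n}"
  shows "measure_pmf.expectation (random_coloring n) (character F) = 0"
proof -
  have "F \<noteq> {}" using assms by (simp add: even_edge_sets_def)
  then obtain e where "e \<in> F" by blast
  then have "\<not> (\<forall>e. even (card {i \<in> {()}. e \<in> F}))"
    by (auto intro!: exI[of _ e])
  then show ?thesis
    using expectation_prod_character[of "{()}" "\<lambda>_. F" n] even_edge_sets_subset[OF assms]
    by simp
qed

lemma num_mono_centred:
  assumes "2 \<le> k"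
  shows "num_mono k n c - mean_mono k n =
           2 / 2 ^ (k choose 2) * (\<Sum>S\<in>nsets {1..n} k. \<Sum>F\<in>even_edge_sets S. character F c)"
proof -
  let ?q = "2 / 2 ^ (k choose 2) :: real"
  let ?N = "nsets {1..n} k"
  have num: "num_mono k n c = card ?N * ?q + ?q * (\<Sum>S\<in>?N. \<Sum>F\<in>even_edge_sets S. character F c)" for c
  proof -
    have "num_mono k n c = (\<Sum>S\<in>?N. ?q * (1 + (\<Sum>F\<in>even_edge_sets S. character F c)))"
      unfolding num_mono_def
      by (intro sum.cong refl) (use assms in \<open>auto simp: nsets_def of_bool_monochromatic\<close>)
    then show ?thesis by (simp only: sum_distrib_left[symmetric] sum.distrib distrib_left sum_constant mult_1_right)
  qed
  have int: "integrable (measure_pmf (random_coloring n)) f" for f :: "_ \<Rightarrow> real"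
    unfolding random_coloring_def
    by (intro integrable_measure_pmf_finite) (simp add: finite_colorings colorings_nonempty)
  have "mean_mono k n = card ?N * ?q +
     ?q * (\<Sum>S\<in>?N. \<Sum>F\<in>even_edge_sets S. measure_pmf.expectation (random_coloring n) (character F))"
    unfolding mean_mono_def num by (simp add: int Bochner_Integration.integral_add Bochner_Integration.integral_sum)
  also have "(\<Sum>S\<in>?N. \<Sum>F\<in>even_edge_sets S. measure_pmf.expectation (random_coloring n) (character F)) = 0"
    by (intro sum.neutral ballI expectation_character) (auto simp: nsets_def)
  finally show ?thesis by (simp add: num)
qed

lemma central_moment_eq_sum_cancelling:
  assumes "2 \<le> k"
  shows "central_moment r k n =
           (2 / 2 ^ (k choose 2)) ^ r *
             real (\<Sum>S\<in>{..<r} \<rightarrow>\<^sub>E nsets {1..n} k. card (cancelling {..<r} S))"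
proof -
  let ?q = "2 / 2 ^ (k choose 2) :: real" and ?N = "nsets {1..n} k" and ?I = "{..<r}"
  have finN: "finite ?N" by (simp add: finite_imp_finite_nsets)
  have finS: "finite (even_edge_sets (S i))" if "S \<in> ?I \<rightarrow>\<^sub>E ?N" "i \<in> ?I" for S i
    using that by (intro finite_even_edge_sets) (auto simp: nsets_def dest!: PiE_mem)
  have int: "integrable (measure_pmf (random_coloring n)) f" for f :: "_ \<Rightarrow> real"
    unfolding random_coloring_def
    by (intro integrable_measure_pmf_finite) (simp add: finite_colorings colorings_nonempty)
  have expand: "(num_mono k n c - mean_mono k n) ^ r = ?q ^ r *
      (\<Sum>S\<in>?I \<rightarrow>\<^sub>E ?N. \<Sum>F\<in>(\<Pi>\<^sub>E i\<in>?I. even_edge_sets (S i)). \<Prod>i\<in>?I. character (F i) c)" for c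
  proof -
    have "(\<Sum>S\<in>?N. \<Sum>F\<in>even_edge_sets S. character F c) ^ r =
          (\<Prod>i\<in>?I. \<Sum>S\<in>?N. \<Sum>F\<in>even_edge_sets S. character F c)"
      by simp
    also have "\<dots> = (\<Sum>S\<in>?I \<rightarrow>\<^sub>E ?N. \<Prod>i\<in>?I. \<Sum>F\<in>even_edge_sets (S i). character F c)"
      by (rule prod_sum_PiE) (use finN in auto)
    also have "\<dots> = (\<Sum>S\<in>?I \<rightarrow>\<^sub>E ?N. \<Sum>F\<in>(\<Pi>\<^sub>E i\<in>?I. even_edge_sets (S i)). \<Prod>i\<in>?I. character (F i) c)"
      by (intro sum.cong refl prod_sum_PiE) (use finS in auto)
    finally show ?thesis
      unfolding num_mono_centred[OF assms] power_mult_distrib by simp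
  qed
  have "central_moment r k n = ?q ^ r * (\<Sum>S\<in>?I \<rightarrow>\<^sub>E ?N. \<Sum>F\<in>(\<Pi>\<^sub>E i\<in>?I. even_edge_sets (S i)).
      measure_pmf.expectation (random_coloring n) (\<lambda>c. \<Prod>i\<in>?I. character (F i) c))"
    unfolding central_moment_def expand
    by (simp add: int Bochner_Integration.integral_sum)
  also have "(\<Sum>F\<in>(\<Pi>\<^sub>E i\<in>?I. even_edge_sets (S i)).
      measure_pmf.expectation (random_coloring n) (\<lambda>c. \<Prod>i\<in>?I. character (F i) c))
      = real (card (cancelling ?I S))" if S: "S \<in> ?I \<rightarrow>\<^sub>E ?N" for S
  proof -
    have "(\<Sum>F\<in>(\<Pi>\<^sub>E i\<in>?I. even_edge_sets (S i)).
        measure_pmf.expectation (random_coloring n) (\<lambda>c. \<Prod>i\<in>?I. character (F i) c))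
      = (\<Sum>F\<in>(\<Pi>\<^sub>E i\<in>?I. even_edge_sets (S i)). of_bool (\<forall>e. even (card {i \<in> ?I. e \<in> F i})))"
    proof (intro sum.cong refl expectation_prod_character)
      fix F i assume F: "F \<in> (\<Pi>\<^sub>E i\<in>?I. even_edge_sets (S i))" and i: "i \<in> ?I"
      from S i have "S i \<subseteq> {1..n}" by (auto simp: nsets_def dest!: PiE_mem)
      with PiE_mem[OF F i] show "F i \<subseteq> nsets {1..n} 2" by (rule even_edge_sets_subset)
    qed auto
    also have "\<dots> = real (card (cancelling ?I S))"
    proof -
      have f: "finite (\<Pi>\<^sub>E i\<in>?I. even_edge_sets (S i))"
        by (intro finite_PiE) (use finS[OF S] in auto)
      show ?thesis unfolding cancelling_def using f
        by (simp add: of_bool_def sum.inter_filter[symmetric])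
    qed
    finally show ?thesis .
  qed
  then have "(\<Sum>S\<in>?I \<rightarrow>\<^sub>E ?N. \<Sum>F\<in>(\<Pi>\<^sub>E i\<in>?I. even_edge_sets (S i)).
      measure_pmf.expectation (random_coloring n) (\<lambda>c. \<Prod>i\<in>?I. character (F i) c))
      = real (\<Sum>S\<in>?I \<rightarrow>\<^sub>E ?N. card (cancelling ?I S))" by simp
  finally show ?thesis .
qed

section \<open>Polynomial dependence on the number of vertices\<close>

text \<open>
  Requiring the whole of \<open>V\<close> to be covered assigns each tuple of cliques to exactly one vertex set.
\<close>

definition covers :: "nat \<Rightarrow> 'i set \<Rightarrow> 'a set \<Rightarrow> ('i \<Rightarrow> 'a set) set" where
  "covers k I V = {S \<in> I \<rightarrow>\<^sub>E nsets V k. (\<Union>i\<in>I. S i) = V}"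

definition weight :: "nat \<Rightarrow> 'i set \<Rightarrow> 'a set \<Rightarrow> nat" where
  "weight k I V = (\<Sum>S\<in>covers k I V. card (cancelling I S))"

lemma finite_covers: "finite I \<Longrightarrow> finite V \<Longrightarrow> finite (covers k I V)"
  unfolding covers_def by (simp add: finite_PiE finite_imp_finite_nsets)

lemma coversD:
  assumes "S \<in> covers k I V" "i \<in> I"
  shows "S i \<subseteq> V" "finite (S i)" "card (S i) = k"
  using assms by (auto simp: covers_def nsets_def dest!: PiE_mem)

lemma even_edge_sets_image:
  assumes F: "F \<in> even_edge_sets S" and inj: "inj_on f S"
  shows "(`) f ` F \<in> even_edge_sets (f ` S)"
proof -
  have sub: "F \<subseteq> nsets S 2" using F by (simp add: even_edge_sets_def)
  have "inj_on ((`) f) F"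
    using inj_on_nsets[OF inj] sub by (rule inj_on_subset)
  moreover have "f ` e \<in> nsets (f ` S) 2" if "e \<in> F" for e
    using that sub inj by (auto simp: nsets_def card_image inj_on_subset)
  ultimately show ?thesis
    using F by (auto simp: even_edge_sets_def card_image)
qed

text \<open>
  Relabelling vertices injectively carries cancelling families to cancelling families; the
  inequalities for a bijection and its inverse combine to the equality of weights.
\<close>

lemma card_cancelling_image_le:
  fixes S :: "'i \<Rightarrow> 'a set" and f :: "'a \<Rightarrow> 'b"
  assumes "finite I" "finite V" and inj: "inj_on f V" and S: "\<And>i. i \<in> I \<Longrightarrow> S i \<subseteq> V"
  shows "card (cancelling I S) \<le> card (cancelling I (\<lambda>i\<in>I. f ` S i))"
proof (rule card_inj_on_le)
  let ?h = "\<lambda>F. \<lambda>i\<in>I. (`) f ` F i"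
  have edges: "F i \<in> Pow (Pow V)" if "F \<in> cancelling I S" "i \<in> I" for F i
  proof -
    have "F i \<in> even_edge_sets (S i)" using that by (auto simp: cancelling_def dest: PiE_mem)
    then show ?thesis using S[OF that(2)] by (auto simp: even_edge_sets_def nsets_def)
  qed
  have inj2: "inj_on ((`) f) (Pow V)" using inj by (rule inj_on_image_Pow)
  have inj3: "inj_on ((`) ((`) f)) (Pow (Pow V))" using inj2 by (rule inj_on_image_Pow)
  show "inj_on ?h (cancelling I S)"
  proof (rule inj_onI)
    fix F G assume FG: "F \<in> cancelling I S" "G \<in> cancelling I S" and eq: "?h F = ?h G"
    show "F = G"
    proof (rule PiE_ext)
      show "F \<in> (\<Pi>\<^sub>E i\<in>I. even_edge_sets (S i))" "G \<in> (\<Pi>\<^sub>E i\<in>I. even_edge_sets (S i))"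
        using FG by (auto simp: cancelling_def)
      fix i assume i: "i \<in> I"
      have "(`) f ` F i = (`) f ` G i" using fun_cong[OF eq, of i] i by simp
      then show "F i = G i"
        by (rule inj_onD[OF inj3]) (use edges FG i in blast)+
    qed
  qed
  show "?h ` cancelling I S \<subseteq> cancelling I (\<lambda>i\<in>I. f ` S i)"
  proof (rule image_subsetI)
    fix F assume F: "F \<in> cancelling I S"
    have "?h F i \<in> even_edge_sets ((\<lambda>i\<in>I. f ` S i) i)" if i: "i \<in> I" for i
      using F i even_edge_sets_image[of "F i" "S i" f] inj_on_subset[OF inj S[OF i]]
      by (auto simp: cancelling_def dest: PiE_mem)
    moreover have "even (card {i \<in> I. e' \<in> ?h F i})" for e'
    proof (cases "\<exists>e\<in>Pow V. e' = f ` e")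
      case True
      then obtain e where e: "e \<in> Pow V" "e' = f ` e" by blast
      have "{i \<in> I. e' \<in> ?h F i} = {i \<in> I. e \<in> F i}"
      proof (intro Collect_cong conj_cong refl)
        fix i assume i: "i \<in> I"
        show "e' \<in> ?h F i \<longleftrightarrow> e \<in> F i"
          using inj_on_image_mem_iff[OF inj2 e(1), of "F i"] edges[OF F i] i e(2) by simp
      qed
      then show ?thesis using F by (simp add: cancelling_def)
    next
      case False
      then have "e' \<notin> ?h F i" if "i \<in> I" for i using edges[OF F that] that by auto
      then have "{i \<in> I. e' \<in> ?h F i} = {}" by blast
      then show ?thesis by (simp only: card.empty even_zero)
    qed
    ultimately show "?h F \<in> cancelling I (\<lambda>i\<in>I. f ` S i)"
      unfolding cancelling_def by auto
  qed
  show "finite (cancelling I (\<lambda>i\<in>I. f ` S i))"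
    using assms by (intro finite_cancelling) (auto intro: finite_subset)
qed

lemma weight_image_le:
  assumes "finite I" "finite V" and inj: "inj_on f V"
  shows "weight k I V \<le> weight k I (f ` V)"
proof -
  let ?g = "\<lambda>S. \<lambda>i\<in>I. f ` S i"
  have inj_g: "inj_on ?g (covers k I V)"
  proof (rule inj_onI)
    fix S T assume ST: "S \<in> covers k I V" "T \<in> covers k I V" and eq: "?g S = ?g T"
    show "S = T"
    proof (rule PiE_ext)
      show "S \<in> I \<rightarrow>\<^sub>E nsets V k" "T \<in> I \<rightarrow>\<^sub>E nsets V k" using ST by (auto simp: covers_def)
      fix i assume i: "i \<in> I"
      have "f ` S i = f ` T i" using fun_cong[OF eq, of i] i by simp
      then show "S i = T i"
        using inj_on_image_eq_iff[OF inj] coversD(1)[OF ST(1) i] coversD(1)[OF ST(2) i] by blast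
    qed
  qed
  have range_g: "?g ` covers k I V \<subseteq> covers k I (f ` V)"
  proof (rule image_subsetI)
    fix S assume S: "S \<in> covers k I V"
    have "f ` S i \<in> nsets (f ` V) k" if "i \<in> I" for i
      using coversD[OF S that] inj by (auto simp: nsets_def card_image inj_on_subset)
    moreover have "(\<Union>i\<in>I. f ` S i) = f ` V"
      using S by (auto simp: covers_def)
    ultimately show "?g S \<in> covers k I (f ` V)" by (auto simp: covers_def)
  qed
  have "weight k I V \<le> (\<Sum>S\<in>covers k I V. card (cancelling I (?g S)))"
    unfolding weight_def
    by (intro sum_mono card_cancelling_image_le[OF assms] coversD(1))
  also have "\<dots> = (\<Sum>T\<in>?g ` covers k I V. card (cancelling I T))"
    using inj_g by (simp add: sum.reindex)
  also have "\<dots> \<le> weight k I (f ` V)"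
    unfolding weight_def using range_g assms by (intro sum_mono2 finite_covers) auto
  finally show ?thesis .
qed

lemma weight_cong_card:
  assumes "finite I" "finite V" "finite V'" "card V = card V'"
  shows "weight k I V = weight k I V'"
proof (rule antisym)
  obtain f where "bij_betw f V V'" using finite_same_card_bij assms by blast
  then show "weight k I V \<le> weight k I V'"
    using weight_image_le[OF assms(1,2), of f] by (simp add: bij_betw_def)
  obtain g where "bij_betw g V' V" using finite_same_card_bij assms by metis
  then show "weight k I V' \<le> weight k I V"
    using weight_image_le[OF assms(1,3), of g] by (simp add: bij_betw_def)
qed

lemma sum_cancelling_eq_weights:
  assumes "finite I"
  shows "(\<Sum>S\<in>I \<rightarrow>\<^sub>E nsets {1..n::nat} k. card (cancelling I S))
           = (\<Sum>v\<le>n. (n choose v) * weight k I {1..v})"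
proof -
  let ?W = "{1..n}" and ?f = "\<lambda>S. card (cancelling I S)"
  have "(\<Sum>S\<in>I \<rightarrow>\<^sub>E nsets ?W k. ?f S) =
      (\<Sum>V\<in>Pow ?W. \<Sum>S\<in>{S \<in> I \<rightarrow>\<^sub>E nsets ?W k. (\<Union>i\<in>I. S i) = V}. ?f S)"
  proof (rule sum.group[symmetric])
    show "finite (I \<rightarrow>\<^sub>E nsets ?W k)"
      using assms by (intro finite_PiE) (use finite_imp_finite_nsets in blast)+
    show "(\<lambda>S. \<Union>i\<in>I. S i) ` (I \<rightarrow>\<^sub>E nsets ?W k) \<subseteq> Pow ?W"
      by (fastforce simp: nsets_def dest!: PiE_mem)
  qed simp
  also have "\<dots> = (\<Sum>V\<in>Pow ?W. weight k I V)"
  proof (intro sum.cong refl)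
    fix V assume "V \<in> Pow ?W"
    then have "{S \<in> I \<rightarrow>\<^sub>E nsets ?W k. (\<Union>i\<in>I. S i) = V} = covers k I V"
      unfolding covers_def nsets_def by (auto simp: PiE_iff)
    then show "(\<Sum>S\<in>{S \<in> I \<rightarrow>\<^sub>E nsets ?W k. (\<Union>i\<in>I. S i) = V}. ?f S) = weight k I V"
      by (simp add: weight_def)
  qed
  also have "\<dots> = (\<Sum>v\<le>n. \<Sum>V\<in>{V \<in> Pow ?W. card V = v}. weight k I V)"
    by (rule sum.group[symmetric]) (use card_mono[of ?W] in auto)
  also have "\<dots> = (\<Sum>v\<le>n. (n choose v) * weight k I {1..v})"
  proof (intro sum.cong refl)
    fix v
    have "{V \<in> Pow ?W. card V = v} = nsets ?W v" by (auto simp: nsets_def intro: finite_subset)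
    then have "card {V \<in> Pow ?W. card V = v} = n choose v" by (simp add: card_nsets del: One_nat_def)
    moreover have "weight k I V = weight k I {1..v}" if "V \<in> {V \<in> Pow ?W. card V = v}" for V
      using that assms by (intro weight_cong_card) (auto intro: finite_subset)
    ultimately show "(\<Sum>V\<in>{V \<in> Pow ?W. card V = v}. weight k I V) = (n choose v) * weight k I {1..v}"
      by simp
  qed
  finally show ?thesis .
qed

text \<open>
  The falling factorial divided by \<open>fact v\<close>, so that its values are binomial coefficients.
\<close>

definition binomial_poly :: "nat \<Rightarrow> real poly" where
  "binomial_poly v = smult (1 / fact v) (\<Prod>i<v. [:- real i, 1:])"

lemma poly_binomial_poly: "poly (binomial_poly v) (real n) = real (n choose v)"
  by (simp add: binomial_poly_def poly_prod binomial_gbinomial gbinomial_prod_rev atLeast0LessThan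
      prod_dividef)

lemma degree_binomial_poly: "degree (binomial_poly v) = v"
  by (simp add: binomial_poly_def degree_prod_eq_sum_degree)

lemma lead_coeff_binomial_poly: "coeff (binomial_poly v) v = 1 / fact v"
proof -
  have "lead_coeff (\<Prod>i<v. [:- real i, 1:]) = 1" by (simp add: lead_coeff_prod)
  moreover have "degree (\<Prod>i<v. [:- real i, 1:]) = v" by (simp add: degree_prod_eq_sum_degree)
  ultimately show ?thesis by (simp add: binomial_poly_def)
qed

text \<open>
  Each \<open>binomial_poly v\<close> has degree exactly \<open>v\<close>, so the largest index with a nonzero
  coefficient determines the leading term alone.
\<close>

lemma has_leading_term_binomial_sum:
  assumes f: "\<And>n. f n = a * (\<Sum>v\<le>n. real (n choose v) * w v)"
    and zero: "\<And>v. v > d \<Longrightarrow> w v = 0" and nz: "w d \<noteq> 0" "a \<noteq> 0"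
  shows "has_leading_term f (a * (w d / fact d)) d"
  unfolding has_leading_term_def
proof (intro exI conjI allI impI)
  define p where "p = smult a (\<Sum>v\<le>d. smult (w v) (binomial_poly v))"
  show "f n = poly p (real n)" for n
  proof -
    have "(\<Sum>v\<le>n. real (n choose v) * w v) = (\<Sum>v\<le>max n d. real (n choose v) * w v)"
      by (rule sum.mono_neutral_left) (auto simp: binomial_eq_0)
    also have "\<dots> = (\<Sum>v\<le>d. real (n choose v) * w v)"
      by (rule sum.mono_neutral_right) (auto simp: zero)
    finally show ?thesis
      by (simp add: f p_def poly_sum poly_binomial_poly mult.commute)
  qed
  have c: "coeff p d = a * (w d / fact d)"
  proof -
    have "coeff p d = a * (\<Sum>v\<le>d. w v * coeff (binomial_poly v) d)"
      by (simp add: p_def coeff_sum)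
    also have "(\<Sum>v\<le>d. w v * coeff (binomial_poly v) d) = (\<Sum>v\<in>{d}. w v * coeff (binomial_poly v) d)"
      by (rule sum.mono_neutral_right) (auto simp: coeff_eq_0 degree_binomial_poly)
    finally show ?thesis by (simp add: lead_coeff_binomial_poly)
  qed
  have le: "degree p \<le> d"
    unfolding p_def
    by (intro order.trans[OF degree_smult_le] degree_sum_le finite_atMost)
       (auto intro: order.trans[OF degree_smult_le] simp: degree_binomial_poly)
  have "coeff p d \<noteq> 0" using c nz by simp
  with le show deg: "degree p = d" by (intro antisym le_degree)
  show "lead_coeff p = a * (w d / fact d)" using c deg by simp
qed

lemma has_leading_term_central_moment:
  assumes "2 \<le> k"
    and "\<And>v. v > d \<Longrightarrow> weight k {..<r} {1..v::nat} = 0"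
    and "weight k {..<r} {1..d} \<noteq> 0"
  shows "has_leading_term (central_moment r k)
           ((2 / 2 ^ (k choose 2)) ^ r * (real (weight k {..<r} {1..d}) / fact d)) d"
  by (rule has_leading_term_binomial_sum)
     (use assms in \<open>simp_all add: central_moment_eq_sum_cancelling sum_cancelling_eq_weights
        del: One_nat_def\<close>)

section \<open>How few vertices the cliques of a contributing family can share\<close>

definition incidence :: "'i set \<Rightarrow> ('i \<Rightarrow> 'a set) \<Rightarrow> 'a \<Rightarrow> nat" where
  "incidence I S v = card {i \<in> I. v \<in> S i}"

definition shared :: "'i set \<Rightarrow> ('i \<Rightarrow> 'a set) \<Rightarrow> 'a set" where
  "shared I S = {v. 2 \<le> incidence I S v}"

lemma cancelling_edge_sets: "F \<in> cancelling I S \<Longrightarrow> i \<in> I \<Longrightarrow> F i \<in> even_edge_sets (S i)"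
  by (auto simp: cancelling_def dest: PiE_mem)

lemma cancelling_edgeD:
  assumes "F \<in> cancelling I S" "i \<in> I" "e \<in> F i"
  shows "e \<subseteq> S i" "card e = 2"
  using cancelling_edge_sets[OF assms(1,2)] assms(3) by (auto simp: even_edge_sets_def nsets_def)

lemma cancelling_other:
  assumes "finite I" "F \<in> cancelling I S" "i \<in> I" "e \<in> F i"
  obtains j where "j \<in> I" "j \<noteq> i" "e \<in> F j"
proof -
  have "even (card {j \<in> I. e \<in> F j})" using assms by (simp add: cancelling_def)
  then have "{j \<in> I. e \<in> F j} \<noteq> {i}" by auto
  with assms(3,4) that show ?thesis by blast
qed

lemma mem_shared:
  assumes "finite I" "i \<in> I" "j \<in> I" "i \<noteq> j" "v \<in> S i" "v \<in> S j"
  shows "v \<in> shared I S"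
proof -
  have "card {i, j} \<le> incidence I S v"
    unfolding incidence_def using assms by (intro card_mono) auto
  then show ?thesis using assms(4) by (simp add: shared_def)
qed

lemma incidence_le_2_cases:
  assumes "finite I" "incidence I S v \<le> 2" "{i, j, l} \<subseteq> I" "v \<in> S i" "v \<in> S j" "v \<in> S l"
  shows "i = j \<or> i = l \<or> j = l"
proof (rule ccontr)
  assume "\<not> ?thesis"
  then have "3 = card {i, j, l}" by auto
  also have "\<dots> \<le> incidence I S v"
    unfolding incidence_def using assms by (intro card_mono) auto
  finally show False using assms(2) by simp
qed

lemma cancelling_subset_shared:
  assumes "finite I" "F \<in> cancelling I S" "i \<in> I"
  shows "F i \<subseteq> nsets (S i \<inter> shared I S) 2"
proof
  fix e assume e: "e \<in> F i"
  then obtain j where j: "j \<in> I" "j \<noteq> i" "e \<in> F j" by (rule cancelling_other[OF assms])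
  have "e \<subseteq> S i" "e \<subseteq> S j" "card e = 2"
    using cancelling_edgeD[OF assms(2)] assms(3) e j by blast+
  moreover from this have "e \<subseteq> shared I S"
    by (auto intro!: mem_shared[OF assms(1,3) j(1) j(2)[symmetric]])
  ultimately show "e \<in> nsets (S i \<inter> shared I S) 2"
    by (auto simp: nsets_def card_2_iff)
qed

lemma cancelling_two_edges:
  assumes "F \<in> cancelling I S" "i \<in> I"
  obtains e f where "e \<in> F i" "f \<in> F i" "e \<noteq> f"
proof -
  have F: "F i \<noteq> {}" "even (card (F i))"
    using cancelling_edge_sets[OF assms(1,2)] by (simp_all add: even_edge_sets_def)
  then obtain e where e: "e \<in> F i" by blast
  have "F i \<noteq> {e}" using F(2) by auto
  with e obtain f where "f \<in> F i" "e \<noteq> f" by blast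
  with e show ?thesis by (rule that)
qed

text \<open>
  All edges of \<open>F i\<close> join shared vertices, and there are at least two of them; two vertices
  span only one edge.
\<close>

lemma three_shared_vertices:
  assumes "finite I" "F \<in> cancelling I S" "i \<in> I" "finite (S i)"
  shows "3 \<le> card (S i \<inter> shared I S)"
proof (rule ccontr)
  let ?T = "S i \<inter> shared I S"
  assume "\<not> 3 \<le> card ?T"
  then have le: "card ?T \<le> 2" by simp
  obtain e f where ef: "e \<in> F i" "f \<in> F i" "e \<noteq> f"
    by (rule cancelling_two_edges[OF assms(2,3)])
  have only: "x = ?T" if "x \<in> F i" for x
  proof -
    have "x \<subseteq> ?T" "card x = 2"
      using that cancelling_subset_shared[OF assms(1-3)] by (auto simp: nsets_def)
    then show ?thesis using le assms(4) by (intro card_seteq) auto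
  qed
  have "e = f" using only[OF ef(1)] only[OF ef(2)] by (simp only:)
  with ef(3) show False by contradiction
qed

text \<open>
  With only three shared vertices, two edges of \<open>F i\<close> form a path through all of them. Each edge
  lies in some other clique, and as the middle vertex is in only one other clique, this clique
  is the same for both edges.
\<close>

lemma partner:
  assumes "finite I" "F \<in> cancelling I S" "i \<in> I" "finite (S i)"
    and three: "card (S i \<inter> shared I S) = 3"
    and two: "\<And>v. v \<in> S i \<inter> shared I S \<Longrightarrow> incidence I S v = 2"
  obtains j where "j \<in> I" "j \<noteq> i" "S i \<inter> shared I S \<subseteq> S j"
proof -
  let ?T = "S i \<inter> shared I S"
  obtain e f where ef: "e \<in> F i" "f \<in> F i" "e \<noteq> f"
    by (rule cancelling_two_edges[OF assms(2,3)])
  have sub: "e \<subseteq> ?T" "f \<subseteq> ?T" and c2: "card e = 2" "card f = 2"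
    using ef cancelling_subset_shared[OF assms(1-3)] by (auto simp: nsets_def)
  have fin: "finite ?T" "finite e" "finite f" using assms(4) sub by (auto intro: finite_subset)
  have gt: "card e < card (e \<union> f)"
  proof (rule psubset_card_mono)
    have "\<not> f \<subseteq> e" using ef(3) c2 fin card_seteq[of e f] by auto
    then show "e \<subset> e \<union> f" by auto
  qed (use fin in simp)
  then have T: "e \<union> f = ?T"
    using sub three fin c2 by (intro card_seteq) auto
  have "card (e \<inter> f) > 0"
    using card_Un_Int[OF fin(2,3)] T three c2 by simp
  then obtain b where b: "b \<in> e" "b \<in> f" by (auto simp: card_gt_0_iff)
  obtain j where j: "j \<in> I" "j \<noteq> i" "e \<in> F j" using cancelling_other[OF assms(1-3) ef(1)] .
  obtain l where l: "l \<in> I" "l \<noteq> i" "f \<in> F l" using cancelling_other[OF assms(1-3) ef(2)] .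
  have ej: "e \<subseteq> S j" and fl: "f \<subseteq> S l" using cancelling_edgeD[OF assms(2)] j l by blast+
  have "b \<in> S i" "b \<in> S j" "b \<in> S l" "incidence I S b = 2" using b sub ej fl two by blast+
  then have "j = l"
    using incidence_le_2_cases[OF assms(1), of S b i j l] j l assms(3) by auto
  then show ?thesis using that[of j] j T ej fl by blast
qed

lemma incidence_pos:
  assumes "finite I" "S \<in> covers k I V" "v \<in> V"
  shows "1 \<le> incidence I S v"
proof -
  obtain i where "i \<in> I" "v \<in> S i" using assms(2,3) by (auto simp: covers_def)
  then have "{i \<in> I. v \<in> S i} \<noteq> {}" by blast
  then show ?thesis unfolding incidence_def using assms(1) by (simp add: Suc_le_eq card_gt_0_iff)
qed

lemma shared_subset:
  assumes "S \<in> covers k I V"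
  shows "shared I S \<subseteq> V"
proof
  fix v assume "v \<in> shared I S"
  then have "{i \<in> I. v \<in> S i} \<noteq> {}" unfolding shared_def incidence_def by fastforce
  then show "v \<in> V" using assms by (auto simp: covers_def)
qed

lemma sum_card_Int_eq_sum_incidence:
  assumes "finite I" "finite U"
  shows "(\<Sum>i\<in>I. card (S i \<inter> U)) = (\<Sum>v\<in>U. incidence I S v)"
proof -
  have "card (S i \<inter> U) = (\<Sum>v\<in>U. of_bool (v \<in> S i))" for i
    using assms by (simp add: of_bool_def sum.inter_filter[symmetric] Int_def conj_commute)
  moreover have "incidence I S v = (\<Sum>i\<in>I. of_bool (v \<in> S i))" for v
    using assms by (simp add: incidence_def of_bool_def sum.inter_filter[symmetric])
  ultimately show ?thesis by (simp add: sum.swap[of _ I U])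
qed

text \<open>
  Both \<open>k * card I\<close> and the total number of shared vertices of the cliques count incidences
  between cliques and vertices. The two sums on the right are the surpluses that must be
  small for \<open>V\<close> to be large. Their natural number subtractions never truncate: this is
  \<open>three_shared_vertices\<close> for the first and the definition of \<open>shared\<close> for the second.
\<close>

lemma excess_identity:
  assumes fin: "finite I" "finite V" and S: "S \<in> covers k I V" and "cancelling I S \<noteq> {}"
  shows "2 * k * card I = 3 * card I + 2 * card V
     + (\<Sum>i\<in>I. card (S i \<inter> shared I S) - 3) + (\<Sum>v\<in>shared I S. incidence I S v - 2)"
proof -
  let ?U = "shared I S" and ?m = "incidence I S"
  obtain F where F: "F \<in> cancelling I S" using assms by blast
  have U: "?U \<subseteq> V" "finite ?U" using shared_subset[OF S] fin by (auto intro: finite_subset)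
  have "k * card I = (\<Sum>i\<in>I. card (S i \<inter> V))"
    using coversD[OF S] by (simp add: Int_absorb2)
  also have "\<dots> = (\<Sum>v\<in>V. ?m v)" using fin by (rule sum_card_Int_eq_sum_incidence)
  also have "\<dots> = (\<Sum>v\<in>?U. ?m v) + (\<Sum>v\<in>V - ?U. ?m v)"
    using U fin sum.subset_diff[of ?U V ?m] by simp
  also have "(\<Sum>v\<in>V - ?U. ?m v) = (\<Sum>v\<in>V - ?U. 1)"
  proof (intro sum.cong refl)
    fix v assume "v \<in> V - ?U"
    then show "?m v = 1" using incidence_pos[OF fin(1) S, of v] by (simp add: shared_def)
  qed
  finally have 1: "k * card I = (\<Sum>v\<in>?U. ?m v) + card (V - ?U)" by simp
  have 2: "card V = card ?U + card (V - ?U)"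
    using U fin by (simp add: card_Diff_subset card_mono)
  have "(\<Sum>v\<in>?U. ?m v) = (\<Sum>v\<in>?U. (?m v - 2) + 2)"
    by (intro sum.cong) (auto simp: shared_def)
  then have 3: "(\<Sum>v\<in>?U. ?m v) = (\<Sum>v\<in>?U. ?m v - 2) + 2 * card ?U"
    by (simp only: sum.distrib sum_constant) simp
  have "(\<Sum>i\<in>I. card (S i \<inter> ?U)) = (\<Sum>i\<in>I. (card (S i \<inter> ?U) - 3) + 3)"
    using three_shared_vertices[OF fin(1) F] coversD(2)[OF S] by (intro sum.cong) auto
  then have 4: "(\<Sum>v\<in>?U. ?m v) = (\<Sum>i\<in>I. card (S i \<inter> ?U) - 3) + 3 * card I"
    unfolding sum_card_Int_eq_sum_incidence[OF fin(1) U(2)]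
    by (simp only: sum.distrib sum_constant) simp
  show ?thesis using 1 2 3 4 by (simp add: mult.assoc)
qed

lemma weight_eq_0:
  assumes "finite I" "finite V" "2 * k * card I < 3 * card I + 2 * card V"
  shows "weight k I V = 0"
proof -
  have "cancelling I S = {}" if "S \<in> covers k I V" for S
  proof (rule ccontr)
    assume "cancelling I S \<noteq> {}"
    then show False using excess_identity[OF assms(1,2) that] assms(3) by linarith
  qed
  then show ?thesis by (simp add: weight_def)
qed

definition detached :: "'i set \<Rightarrow> ('i \<Rightarrow> 'a set) \<Rightarrow> 'i set \<Rightarrow> bool" where
  "detached I S P \<longleftrightarrow> (\<Union>i\<in>P. S i) \<inter> (\<Union>i\<in>I - P. S i) = {}"

text \<open>
  The common triple of two partners is already full: each of its vertices is in just these two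
  cliques, and neither clique has another shared vertex.
\<close>

lemma partners_detached:
  assumes fin: "finite I" and S: "S \<in> covers k I V" and ij: "i \<in> I" "j \<in> I" "i \<noteq> j"
    and three: "card (S i \<inter> shared I S) = 3" "card (S j \<inter> shared I S) = 3"
    and two: "\<And>v. v \<in> S i \<inter> shared I S \<Longrightarrow> incidence I S v = 2"
    and sub: "S i \<inter> shared I S \<subseteq> S j"
  shows "detached I S {i, j}" "card (\<Union>l\<in>{i, j}. S l) = 2 * k - 3"
proof -
  let ?U = "shared I S"
  note f = coversD(2)[OF S ij(1)] coversD(2)[OF S ij(2)]
  have eq: "S i \<inter> ?U = S j \<inter> ?U"
    using sub three f by (intro card_seteq) auto
  have no: "v \<notin> S l" if "v \<in> S i \<union> S j" "l \<in> I - {i, j}" for v l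
  proof
    assume vl: "v \<in> S l"
    have "v \<in> ?U" using that vl ij mem_shared[OF fin, of l i v S] mem_shared[OF fin, of l j v S] by auto
    with that eq have v: "v \<in> S i" "v \<in> S j" "incidence I S v = 2" using two by blast+
    show False using incidence_le_2_cases[OF fin, of S v i j l] v vl that ij by auto
  qed
  then show "detached I S {i, j}" unfolding detached_def by auto
  have "S i \<inter> S j = S i \<inter> ?U"
    using eq mem_shared[OF fin ij, of _ S] by blast
  then show "card (\<Union>l\<in>{i, j}. S l) = 2 * k - 3"
    using card_Un_Int[OF f] three coversD(3)[OF S] ij by simp
qed

section \<open>Splitting off a detached part\<close>

text \<open>
  An edge is nonempty, so it cannot occur on both sides of the splitting; hence cancellation can
  be tested on each side separately.
\<close>

lemma card_cancelling_detached:
  assumes "finite I" "P \<subseteq> I" "detached I S P"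
  shows "card (cancelling I S) = card (cancelling P S) * card (cancelling (I - P) S)"
proof -
  let ?Q = "I - P"
  let ?ok = "\<lambda>I F. \<forall>e. even (card {i \<in> I. e \<in> F i})"
  have fin: "finite P" "finite ?Q" using assms by (auto intro: finite_subset)
  have split: "?ok I F \<longleftrightarrow> ?ok P F \<and> ?ok ?Q F"
    if F: "F \<in> (\<Pi>\<^sub>E i\<in>I. even_edge_sets (S i))" for F
  proof -
    have add: "card {i \<in> I. e \<in> F i} = card {i \<in> P. e \<in> F i} + card {i \<in> ?Q. e \<in> F i}" for e
    proof -
      have "{i \<in> I. e \<in> F i} = {i \<in> P. e \<in> F i} \<union> {i \<in> ?Q. e \<in> F i}" using assms(2) by blast
      then show ?thesis using fin by (simp add: card_Un_disjoint disjoint_iff)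
    qed
    have one: "{i \<in> P. e \<in> F i} = {} \<or> {i \<in> ?Q. e \<in> F i} = {}" for e
    proof (rule ccontr)
      assume "\<not> ?thesis"
      then obtain i j where ij: "i \<in> P" "e \<in> F i" "j \<in> ?Q" "e \<in> F j" by blast
      then have "F i \<in> even_edge_sets (S i)" "F j \<in> even_edge_sets (S j)"
        using F assms(2) by (auto dest: PiE_mem)
      then have "e \<subseteq> S i" "e \<subseteq> S j" "card e = 2"
        using ij by (auto simp: even_edge_sets_def nsets_def)
      then have "e \<noteq> {}" "e \<subseteq> (\<Union>i\<in>P. S i) \<inter> (\<Union>i\<in>?Q. S i)" using ij by auto
      then show False using assms(3) unfolding detached_def by blast
    qed
    have "even (card {i \<in> I. e \<in> F i}) \<longleftrightarrow>
        even (card {i \<in> P. e \<in> F i}) \<and> even (card {i \<in> ?Q. e \<in> F i})" for e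
      using one[of e] unfolding add by (elim disjE) (simp_all only: card.empty, simp_all)
    then show ?thesis by blast
  qed
  have I: "P \<union> ?Q = I" "P \<inter> ?Q = {}" using assms(2) by auto
  have ok_cong: "?ok J F \<longleftrightarrow> ?ok J G" if "\<And>i. i \<in> J \<Longrightarrow> F i = G i" for J and F G :: "'a \<Rightarrow> 'b set set"
  proof -
    have "{i \<in> J. e \<in> F i} = {i \<in> J. e \<in> G i}" for e using that by blast
    then show ?thesis by simp
  qed
  have "bij_betw (\<lambda>F. (restrict F P, restrict F ?Q)) (cancelling I S) (cancelling P S \<times> cancelling ?Q S)"
  proof (rule bij_betw_byWitness[where f' = "merge P ?Q"])
    show "\<forall>F\<in>cancelling I S. merge P ?Q (restrict F P, restrict F ?Q) = F"
    proof
      fix F assume "F \<in> cancelling I S"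
      then have "F \<in> extensional I" by (auto simp: cancelling_def PiE_def)
      then show "merge P ?Q (restrict F P, restrict F ?Q) = F"
        using I by (auto simp: merge_def extensional_def restrict_def fun_eq_iff)
    qed
    show "\<forall>GH\<in>cancelling P S \<times> cancelling ?Q S.
        (restrict (merge P ?Q GH) P, restrict (merge P ?Q GH) ?Q) = GH"
      by (auto simp: cancelling_def merge_def PiE_def extensional_def restrict_def fun_eq_iff)
    show "(\<lambda>F. (restrict F P, restrict F ?Q)) ` cancelling I S \<subseteq> cancelling P S \<times> cancelling ?Q S"
    proof (rule image_subsetI)
      fix F assume F: "F \<in> cancelling I S"
      then have mem: "F \<in> (\<Pi>\<^sub>E i\<in>I. even_edge_sets (S i))" and "?ok I F"
        by (simp_all add: cancelling_def)
      then have "?ok P F" "?ok ?Q F" using split by blast+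
      then have "?ok P (restrict F P)" "?ok ?Q (restrict F ?Q)"
        using ok_cong[of P "restrict F P" F] ok_cong[of ?Q "restrict F ?Q" F] by simp_all
      then show "(restrict F P, restrict F ?Q) \<in> cancelling P S \<times> cancelling ?Q S"
        using mem assms(2) by (auto simp: cancelling_def PiE_iff)
    qed
    show "merge P ?Q ` (cancelling P S \<times> cancelling ?Q S) \<subseteq> cancelling I S"
    proof (rule image_subsetI)
      fix GH assume "GH \<in> cancelling P S \<times> cancelling ?Q S"
      then obtain G H where GH: "GH = (G, H)" "G \<in> cancelling P S" "H \<in> cancelling ?Q S" by blast
      let ?F = "merge P ?Q (G, H)"
      have mem: "?F \<in> (\<Pi>\<^sub>E i\<in>I. even_edge_sets (S i))"
        using GH(2,3) I by (auto simp: cancelling_def PiE_iff merge_def extensional_def)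
      have "?ok P ?F" "?ok ?Q ?F"
        using GH(2,3) ok_cong[of P ?F G] ok_cong[of ?Q ?F H]
        by (simp_all add: cancelling_def merge_def)
      then show "merge P ?Q GH \<in> cancelling I S"
        using mem split[OF mem] GH(1) by (simp add: cancelling_def)
    qed
  qed
  then show ?thesis by (simp add: bij_betw_same_card card_cartesian_product)
qed

lemma cancelling_cong:
  assumes "\<And>i. i \<in> I \<Longrightarrow> S i = T i"
  shows "cancelling I S = cancelling I T"
proof -
  have "(\<Pi>\<^sub>E i\<in>I. even_edge_sets (S i)) = (\<Pi>\<^sub>E i\<in>I. even_edge_sets (T i))"
    using assms by (intro PiE_cong) simp
  then show ?thesis by (simp add: cancelling_def)
qed

lemma sum_detached_fibre:
  assumes "finite I" "P \<subseteq> I" "A \<subseteq> V"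
  shows "(\<Sum>S\<in>{S \<in> covers k I V. detached I S P \<and> (\<Union>i\<in>P. S i) = A}. card (cancelling I S))
           = weight k P A * weight k (I - P) (V - A)"
proof -
  let ?Q = "I - P"
  let ?L = "{S \<in> covers k I V. detached I S P \<and> (\<Union>i\<in>P. S i) = A}"
  have I: "P \<union> ?Q = I" using assms(2) by auto
  have L: "S \<in> ?L \<longleftrightarrow> S \<in> I \<rightarrow>\<^sub>E nsets V k \<and> (\<Union>i\<in>P. S i) = A \<and> (\<Union>i\<in>?Q. S i) = V - A" for S
  proof -
    have "(\<Union>i\<in>I. S i) = (\<Union>i\<in>P. S i) \<union> (\<Union>i\<in>?Q. S i)" using assms(2) by blast
    then show ?thesis unfolding covers_def detached_def using assms(3) by auto
  qed
  have "(\<Sum>S\<in>?L. card (cancelling I S)) =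
      (\<Sum>XY\<in>covers k P A \<times> covers k ?Q (V - A).
         card (cancelling P (fst XY)) * card (cancelling ?Q (snd XY)))"
  proof (rule sum.reindex_bij_witness[where i = "merge P ?Q" and
        j = "\<lambda>S. (restrict S P, restrict S ?Q)"])
    fix S assume S: "S \<in> ?L"
    then have S': "S \<in> I \<rightarrow>\<^sub>E nsets V k" "(\<Union>i\<in>P. S i) = A" "(\<Union>i\<in>?Q. S i) = V - A"
      using iffD1[OF L S] by simp_all
    then have "S \<in> extensional I" by (auto simp: PiE_def)
    then show "merge P ?Q (restrict S P, restrict S ?Q) = S"
      using I by (auto simp: merge_def extensional_def restrict_def fun_eq_iff)
    show "(restrict S P, restrict S ?Q) \<in> covers k P A \<times> covers k ?Q (V - A)"
    proof -
      have "S i \<in> nsets A k" if "i \<in> P" for i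
        using that S' assms(2) by (auto simp: nsets_def PiE_iff)
      moreover have "S i \<in> nsets (V - A) k" if i: "i \<in> ?Q" for i
      proof -
        have "S i \<subseteq> V - A" using S'(3) i by blast
        moreover have "S i \<in> nsets V k" using S'(1) i by (auto simp: PiE_iff)
        ultimately show ?thesis by (simp add: nsets_def)
      qed
      ultimately show ?thesis using S' by (auto simp: covers_def)
    qed
    have "cancelling P (restrict S P) = cancelling P S"
      "cancelling ?Q (restrict S ?Q) = cancelling ?Q S"
      by (intro cancelling_cong; simp)+
    then show "card (cancelling P (fst (restrict S P, restrict S ?Q)))
        * card (cancelling ?Q (snd (restrict S P, restrict S ?Q))) = card (cancelling I S)"
      using S card_cancelling_detached[OF assms(1,2), of S] by simp
  next
    fix XY assume "XY \<in> covers k P A \<times> covers k ?Q (V - A)"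
    then obtain X Y where XY: "XY = (X, Y)" "X \<in> covers k P A" "Y \<in> covers k ?Q (V - A)" by blast
    then show "(restrict (merge P ?Q XY) P, restrict (merge P ?Q XY) ?Q) = XY"
      by (auto simp: covers_def merge_def PiE_def extensional_def restrict_def fun_eq_iff)
    have "(\<Union>i\<in>P. merge P ?Q XY i) = A" "(\<Union>i\<in>?Q. merge P ?Q XY i) = V - A"
      using XY by (simp_all add: covers_def merge_def)
    moreover have "merge P ?Q XY \<in> I \<rightarrow>\<^sub>E nsets V k"
    proof (rule PiE_I)
      fix i assume "i \<in> I"
      then show "merge P ?Q XY i \<in> nsets V k"
        using XY(1) coversD[OF XY(2), of i] coversD[OF XY(3), of i] assms(3)
        by (cases "i \<in> P") (auto simp: merge_def nsets_def)
    next
      fix i assume "i \<notin> I"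
      then show "merge P ?Q XY i = undefined" using XY(1) assms(2) by (auto simp: merge_def)
    qed
    ultimately show "merge P ?Q XY \<in> ?L" by (intro iffD2[OF L] conjI)
  qed
  also have "\<dots> = weight k P A * weight k ?Q (V - A)"
    by (simp add: weight_def sum_product sum.cartesian_product case_prod_beta)
  finally show ?thesis .
qed

text \<open>
  Choosing the set \<open>A\<close> of vertices of the detached part makes the two parts independent.
\<close>

lemma sum_detached:
  assumes "finite I" "finite V" "P \<subseteq> I"
  shows "(\<Sum>S\<in>{S \<in> covers k I V. detached I S P \<and> card (\<Union>i\<in>P. S i) = d}. card (cancelling I S))
           = (\<Sum>A\<in>nsets V d. weight k P A * weight k (I - P) (V - A))"
proof -
  let ?L = "{S \<in> covers k I V. detached I S P \<and> card (\<Union>i\<in>P. S i) = d}"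
  have "(\<Sum>S\<in>?L. card (cancelling I S)) =
      (\<Sum>A\<in>nsets V d. \<Sum>S\<in>{S \<in> ?L. (\<Union>i\<in>P. S i) = A}. card (cancelling I S))"
  proof (rule sum.group[symmetric])
    show "finite ?L" using finite_covers[OF assms(1,2)] by simp
    show "finite (nsets V d)" using assms(2) by (rule finite_imp_finite_nsets)
    show "(\<lambda>S. \<Union>i\<in>P. S i) ` ?L \<subseteq> nsets V d"
    proof (rule image_subsetI)
      fix S assume S: "S \<in> ?L"
      then have "(\<Union>i\<in>P. S i) \<subseteq> V" using coversD(1)[of S k I V] assms(3) by blast
      then show "(\<Union>i\<in>P. S i) \<in> nsets V d"
        using S assms(2) by (auto simp: nsets_def intro: finite_subset)
    qed
  qed
  also have "\<dots> = (\<Sum>A\<in>nsets V d. weight k P A * weight k (I - P) (V - A))"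
  proof (intro sum.cong refl)
    fix A assume A: "A \<in> nsets V d"
    then have "{S \<in> ?L. (\<Union>i\<in>P. S i) = A} = {S \<in> covers k I V. detached I S P \<and> (\<Union>i\<in>P. S i) = A}"
      by (auto simp: nsets_def)
    then show "(\<Sum>S\<in>{S \<in> ?L. (\<Union>i\<in>P. S i) = A}. card (cancelling I S))
        = weight k P A * weight k (I - P) (V - A)"
      using sum_detached_fibre[OF assms(1,3), of A V k] A by (simp add: nsets_def)
  qed
  finally show ?thesis .
qed

section \<open>Counting families by their membership patterns\<close>

text \<open>
  The multinomial coefficient, multiplied out to avoid division.
\<close>

lemma card_functions_with_fibres:
  fixes n :: "'t \<Rightarrow> nat"
  assumes "finite T" "finite V" "(\<Sum>t\<in>T. n t) = card V"
  shows "card {p \<in> V \<rightarrow>\<^sub>E T. \<forall>t\<in>T. card {v \<in> V. p v = t} = n t} * (\<Prod>t\<in>T. fact (n t)) = fact (card V)"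
  using assms
proof (induction T arbitrary: V rule: finite_induct)
  case empty
  then show ?case by simp
next
  case (insert t T)
  let ?L = "{p \<in> V \<rightarrow>\<^sub>E insert t T. \<forall>s\<in>insert t T. card {v \<in> V. p v = s} = n s}"
  let ?R = "\<lambda>W. {p \<in> W \<rightarrow>\<^sub>E T. \<forall>s\<in>T. card {v \<in> W. p v = s} = n s}"
  have n: "n t + (\<Sum>s\<in>T. n s) = card V" using insert by simp
  have fibre: "card {p \<in> ?L. {v \<in> V. p v = t} = A} = card (?R (V - A))" if A: "A \<in> nsets V (n t)" for A
  proof (rule bij_betw_same_card[of "\<lambda>p. restrict p (V - A)"],
      rule bij_betw_byWitness[where f' = "\<lambda>q. \<lambda>v\<in>V. if v \<in> A then t else q v"])
    have AV: "A \<subseteq> V" "card A = n t" using A by (auto simp: nsets_def)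
    show "\<forall>p\<in>{p \<in> ?L. {v \<in> V. p v = t} = A}. (\<lambda>v\<in>V. if v \<in> A then t else restrict p (V - A) v) = p"
      by (auto simp: fun_eq_iff PiE_def extensional_def)
    show "\<forall>q\<in>?R (V - A). restrict (\<lambda>v\<in>V. if v \<in> A then t else q v) (V - A) = q"
      by (auto simp: fun_eq_iff PiE_def extensional_def)
    show "(\<lambda>p. restrict p (V - A)) ` {p \<in> ?L. {v \<in> V. p v = t} = A} \<subseteq> ?R (V - A)"
    proof (rule image_subsetI)
      fix p assume p: "p \<in> {p \<in> ?L. {v \<in> V. p v = t} = A}"
      have "{v \<in> V - A. restrict p (V - A) v = s} = {v \<in> V. p v = s}" if "s \<in> T" for s
        using p that insert.hyps by auto
      with p show "restrict p (V - A) \<in> ?R (V - A)" by (auto simp: PiE_iff)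
    qed
    show "(\<lambda>q. \<lambda>v\<in>V. if v \<in> A then t else q v) ` ?R (V - A) \<subseteq> {p \<in> ?L. {v \<in> V. p v = t} = A}"
    proof (rule image_subsetI)
      fix q assume q: "q \<in> ?R (V - A)"
      let ?p = "\<lambda>v\<in>V. if v \<in> A then t else q v"
      have qT: "q v \<in> T" if "v \<in> V - A" for v using q that by (auto simp: PiE_iff)
      have "{v \<in> V. ?p v = t} = A" using AV qT insert.hyps by auto
      moreover have "{v \<in> V. ?p v = s} = {v \<in> V - A. q v = s}" if "s \<in> T" for s
        using that insert.hyps by auto
      ultimately show "?p \<in> {p \<in> ?L. {v \<in> V. p v = t} = A}"
        using q AV qT by (auto simp: PiE_iff)
    qed
  qed
  have finL: "finite ?L" using insert by (simp add: finite_PiE)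
  have "card ?L = (\<Sum>A\<in>nsets V (n t). card {p \<in> ?L. {v \<in> V. p v = t} = A})"
  proof -
    have "(\<Sum>p\<in>?L. 1::nat) = (\<Sum>A\<in>nsets V (n t). \<Sum>p\<in>{p \<in> ?L. {v \<in> V. p v = t} = A}. 1)"
      by (rule sum.group[symmetric])
         (use insert finL in \<open>auto simp: nsets_def finite_imp_finite_nsets\<close>)
    then show ?thesis by simp
  qed
  also have "\<dots> = (\<Sum>A\<in>nsets V (n t). card (?R (V - A)))" using fibre by simp
  finally have "card ?L * (\<Prod>s\<in>T. fact (n s)) = (\<Sum>A\<in>nsets V (n t). card (?R (V - A)) * (\<Prod>s\<in>T. fact (n s)))"
    by (simp add: sum_distrib_right)
  also have "\<dots> = (\<Sum>A\<in>nsets V (n t). fact (card V - n t))"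
  proof (intro sum.cong refl)
    fix A assume "A \<in> nsets V (n t)"
    then have c: "card (V - A) = card V - n t"
      using insert.prems by (auto simp: nsets_def card_Diff_subset)
    show "card (?R (V - A)) * (\<Prod>s\<in>T. fact (n s)) = fact (card V - n t)"
      using insert.IH[of "V - A"] insert.prems(1) n c by simp
  qed
  also have "\<dots> = (card V choose n t) * fact (card V - n t)"
    by (simp add: card_nsets)
  finally have "card ?L * (\<Prod>s\<in>T. fact (n s)) * fact (n t) = fact (card V)"
    using binomial_fact_lemma[of "n t" "card V"] n by (simp add: mult_ac)
  then show ?case using insert.hyps by (simp add: mult_ac)
qed

text \<open>
  A tuple of cliques is determined by the pattern of each vertex, and counting tuples
  whose patterns occur with prescribed frequencies is a multinomial count.
\<close>

definition pattern :: "'i set \<Rightarrow> ('i \<Rightarrow> 'a set) \<Rightarrow> 'a \<Rightarrow> 'i set" where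
  "pattern I S v = {i \<in> I. v \<in> S i}"

lemma card_pattern: "card (pattern I S v) = incidence I S v"
  by (simp add: pattern_def incidence_def)

lemma pattern_mem:
  assumes "S \<in> covers k I V" "v \<in> V"
  shows "pattern I S v \<in> Pow I - {{}}"
  using assms by (auto simp: pattern_def covers_def)

lemma card_vimage_eq_sum:
  assumes "finite V" "finite T"
  shows "card {v \<in> V. p v \<in> T} = (\<Sum>t\<in>T. card {v \<in> V. p v = t})"
proof -
  have "{v \<in> V. p v \<in> T} = (\<Union>t\<in>T. {v \<in> V. p v = t})" by auto
  also have "card \<dots> = (\<Sum>t\<in>T. card {v \<in> V. p v = t})"
    by (rule card_UN_disjoint) (use assms in auto)
  finally show ?thesis .
qed

text \<open>
  The empty pattern is left out since every vertex is covered, and the last hypothesis is what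
  gives every clique the size \<open>k\<close>.
\<close>

lemma card_covers_with_patterns:
  fixes V :: "'a set" and n :: "'i set \<Rightarrow> nat"
  assumes I: "finite I" and V: "finite V" and n: "(\<Sum>t\<in>Pow I - {{}}. n t) = card V"
    and k: "\<And>i. i \<in> I \<Longrightarrow> (\<Sum>t\<in>{t \<in> Pow I. i \<in> t}. n t) = k"
  shows "card {S \<in> covers k I V. \<forall>t\<in>Pow I - {{}}. card {v \<in> V. pattern I S v = t} = n t}
           * (\<Prod>t\<in>Pow I - {{}}. fact (n t)) = fact (card V)"
proof -
  let ?T = "Pow I - {{}}"
  let ?L = "{S \<in> covers k I V. \<forall>t\<in>?T. card {v \<in> V. pattern I S v = t} = n t}"
  let ?R = "{p \<in> V \<rightarrow>\<^sub>E ?T. \<forall>t\<in>?T. card {v \<in> V. p v = t} = n t}"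
  have "bij_betw (\<lambda>S. restrict (pattern I S) V) ?L ?R"
  proof (rule bij_betw_byWitness[where f' = "\<lambda>p. \<lambda>i\<in>I. {v \<in> V. i \<in> p v}"])
    show "\<forall>S\<in>?L. (\<lambda>i\<in>I. {v \<in> V. i \<in> restrict (pattern I S) V v}) = S"
    proof
      fix S assume "S \<in> ?L"
      then have S: "S \<in> covers k I V" by simp
      show "(\<lambda>i\<in>I. {v \<in> V. i \<in> restrict (pattern I S) V v}) = S"
      proof
        fix i
        show "(\<lambda>i\<in>I. {v \<in> V. i \<in> restrict (pattern I S) V v}) i = S i"
          using S coversD(1)[OF S, of i]
          by (cases "i \<in> I") (auto simp: pattern_def covers_def PiE_def extensional_def)
      qed
    qed
    show "\<forall>p\<in>?R. restrict (pattern I (\<lambda>i\<in>I. {v \<in> V. i \<in> p v})) V = p"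
    proof
      fix p assume p: "p \<in> ?R"
      show "restrict (pattern I (\<lambda>i\<in>I. {v \<in> V. i \<in> p v})) V = p"
      proof
        fix v
        show "restrict (pattern I (\<lambda>i\<in>I. {v \<in> V. i \<in> p v})) V v = p v"
        proof (cases "v \<in> V")
          case True
          then have "p v \<subseteq> I" using p by (auto simp: PiE_iff)
          with True show ?thesis by (auto simp: pattern_def)
        next
          case False
          with p show ?thesis by (auto simp: PiE_def extensional_def)
        qed
      qed
    qed
    show "(\<lambda>S. restrict (pattern I S) V) ` ?L \<subseteq> ?R"
    proof (rule image_subsetI)
      fix S assume S: "S \<in> ?L"
      then have "restrict (pattern I S) V \<in> V \<rightarrow>\<^sub>E ?T"
        using pattern_mem[of S k I V] by (intro restrict_PiE_iff[THEN iffD2]) blast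
      moreover have "{v \<in> V. restrict (pattern I S) V v = t} = {v \<in> V. pattern I S v = t}" for t
        by auto
      ultimately show "restrict (pattern I S) V \<in> ?R" using S by simp
    qed
    show "(\<lambda>p. \<lambda>i\<in>I. {v \<in> V. i \<in> p v}) ` ?R \<subseteq> ?L"
    proof (rule image_subsetI)
      fix p assume p: "p \<in> ?R"
      let ?S = "\<lambda>i\<in>I. {v \<in> V. i \<in> p v}"
      have pT: "p v \<in> ?T" if "v \<in> V" for v using p that by (auto simp: PiE_iff)
      have pat: "pattern I ?S v = p v" if "v \<in> V" for v
        using pT[OF that] that by (auto simp: pattern_def)
      have "card {v \<in> V. i \<in> p v} = k" if i: "i \<in> I" for i
      proof -
        have "{v \<in> V. i \<in> p v} = {v \<in> V. p v \<in> {t \<in> Pow I. i \<in> t}}"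
          using pT by auto
        then have "card {v \<in> V. i \<in> p v} = (\<Sum>t\<in>{t \<in> Pow I. i \<in> t}. card {v \<in> V. p v = t})"
          using card_vimage_eq_sum[OF V, of "{t \<in> Pow I. i \<in> t}" p] I by simp
        also have "\<dots> = (\<Sum>t\<in>{t \<in> Pow I. i \<in> t}. n t)"
          using p by (intro sum.cong) auto
        finally show ?thesis using k[OF i] by simp
      qed
      moreover have "(\<Union>i\<in>I. ?S i) = V" using pT by fastforce
      ultimately have "?S \<in> covers k I V" using V by (auto simp: covers_def nsets_def)
      moreover have "{v \<in> V. pattern I ?S v = t} = {v \<in> V. p v = t}" for t using pat by auto
      ultimately show "?S \<in> ?L" using p by simp
    qed
  qed
  then have "card ?L = card ?R" by (rule bij_betw_same_card)
  then show ?thesis using card_functions_with_fibres[of ?T V n] I V n by simp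
qed

section \<open>Two cliques\<close>

text \<open>
  A nonempty set of an even number of edges of a triangle omits exactly one edge.
\<close>

lemma card_even_edge_sets_triangle:
  assumes "card T = 3"
  shows "card (even_edge_sets T) = 3"
proof -
  have fin: "finite T" using assms by (simp add: card_ge_0_finite)
  have cE: "card (nsets T 2) = 3" using assms by (simp add: card_nsets choose_two)
  have "even_edge_sets T = nsets (nsets T 2) 2"
  proof (intro equalityI subsetI)
    fix F assume F: "F \<in> even_edge_sets T"
    then have sub: "F \<subseteq> nsets T 2" and ne: "F \<noteq> {}" and ev: "even (card F)"
      by (auto simp: even_edge_sets_def)
    have f: "finite F" using sub fin finite_imp_finite_nsets finite_subset by metis
    have "card F \<le> 3" using card_mono[OF finite_imp_finite_nsets[OF fin] sub] cE by simp
    moreover have "card F \<noteq> 0" using f ne by simp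
    ultimately have "card F = 2" using ev by (auto elim!: evenE)
    then show "F \<in> nsets (nsets T 2) 2" using f sub by (simp add: nsets_def)
  next
    fix F assume "F \<in> nsets (nsets T 2) 2"
    then show "F \<in> even_edge_sets T" by (auto simp: nsets_def even_edge_sets_def)
  qed
  then show ?thesis using cE by (simp add: card_nsets choose_two)
qed

text \<open>
  For two cliques cancellation forces \<open>F i = F j\<close>, an even edge set in the common triangle.
\<close>

lemma card_cancelling_pair:
  assumes "i \<noteq> j" "card (S i \<inter> S j) = 3"
  shows "card (cancelling {i, j} S) = 3"
proof -
  let ?I = "{i, j}"
  have ev: "(\<forall>e. even (card {l \<in> ?I. e \<in> F l})) \<longleftrightarrow> F i = F j" for F :: "'a \<Rightarrow> 'b set set"
  proof -
    have "even (card {l \<in> ?I. e \<in> F l}) \<longleftrightarrow> (e \<in> F i \<longleftrightarrow> e \<in> F j)" for e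
    proof -
      have "{l \<in> ?I. e \<in> F l} = (if e \<in> F i then {i} else {}) \<union> (if e \<in> F j then {j} else {})"
        by auto
      then show ?thesis using assms(1) by auto
    qed
    then show ?thesis by auto
  qed
  have eq: "G \<in> even_edge_sets (S i \<inter> S j) \<longleftrightarrow> G \<in> even_edge_sets (S i) \<and> G \<in> even_edge_sets (S j)" for G
    by (auto simp: even_edge_sets_def nsets_def)
  have can: "F \<in> cancelling ?I S \<longleftrightarrow>
      F \<in> extensional ?I \<and> F i \<in> even_edge_sets (S i) \<and> F j \<in> even_edge_sets (S j) \<and> F i = F j"
    for F
    unfolding cancelling_def mem_Collect_eq ev by (auto simp: PiE_def)
  have "bij_betw (\<lambda>G. \<lambda>l\<in>?I. G) (even_edge_sets (S i \<inter> S j)) (cancelling ?I S)"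
  proof (rule bij_betw_byWitness[where f' = "\<lambda>F. F i"])
    show "\<forall>F\<in>cancelling ?I S. (\<lambda>l\<in>?I. F i) = F"
      by (auto simp: can fun_eq_iff extensional_def)
    show "(\<lambda>G. \<lambda>l\<in>?I. G) ` even_edge_sets (S i \<inter> S j) \<subseteq> cancelling ?I S"
      using eq by (auto simp: can)
    show "(\<lambda>F. F i) ` cancelling ?I S \<subseteq> even_edge_sets (S i \<inter> S j)"
    proof (rule image_subsetI)
      fix F assume "F \<in> cancelling ?I S"
      then have "F i \<in> even_edge_sets (S i)" "F j \<in> even_edge_sets (S j)" "F i = F j"
        unfolding can by blast+
      then show "F i \<in> even_edge_sets (S i \<inter> S j)" unfolding eq by metis
    qed
  qed simp
  then show ?thesis
    using card_even_edge_sets_triangle[OF assms(2)] by (simp add: bij_betw_same_card)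
qed

lemma weight_2:
  assumes "3 \<le> k" "card I = 2" "finite V" "card V = 2 * k - 3"
  shows "weight k I V * (2 * fact (k - 3) ^ 2) = fact (2 * k - 3)"
proof -
  obtain i j where I: "I = {i, j}" "i \<noteq> j" using assms(2) by (auto simp: card_2_iff)
  define n where "n = (\<lambda>t :: 'a set. if card t = 2 then 3 else k - 3)"
  have Pow: "Pow I - {{}} = {{i}, {j}, {i, j}}" using I by auto
  have Int: "card (S i \<inter> S j) = 3" if S: "S \<in> covers k I V" for S
  proof -
    have "S i \<union> S j = V" using S I by (auto simp: covers_def)
    then have "k + k = card V + card (S i \<inter> S j)"
      using card_Un_Int[of "S i" "S j"] coversD[OF S] I by simp
    then show ?thesis using assms by simp
  qed
  have pat: "card {v \<in> V. pattern I S v = t} = n t"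
    if S: "S \<in> covers k I V" and t: "t \<in> Pow I - {{}}" for S t
  proof -
    have sub: "S i \<subseteq> V" "S j \<subseteq> V" and fin: "finite (S i)" "finite (S j)"
      and c: "card (S i) = k" "card (S j) = k"
      using coversD[OF S] I by auto
    have "{v \<in> V. pattern I S v = {i}} = S i - S i \<inter> S j"
      "{v \<in> V. pattern I S v = {j}} = S j - S i \<inter> S j"
      "{v \<in> V. pattern I S v = {i, j}} = S i \<inter> S j"
      using sub I by (auto simp: pattern_def)
    moreover have "card (S i - S i \<inter> S j) = k - 3" "card (S j - S i \<inter> S j) = k - 3"
      using fin c Int[OF S] by (simp_all add: card_Diff_subset)
    ultimately show ?thesis using t Int[OF S] I unfolding Pow by (auto simp: n_def)
  qed
  have "weight k I V = (\<Sum>S\<in>covers k I V. 3)"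
    unfolding weight_def using card_cancelling_pair[OF I(2)] Int I(1) by (intro sum.cong) auto
  then have w: "weight k I V = card (covers k I V) * 3" by simp
  have "{S \<in> covers k I V. \<forall>t\<in>Pow I - {{}}. card {v \<in> V. pattern I S v = t} = n t} = covers k I V"
    using pat by blast
  moreover have "card {S \<in> covers k I V. \<forall>t\<in>Pow I - {{}}. card {v \<in> V. pattern I S v = t} = n t}
           * (\<Prod>t\<in>Pow I - {{}}. fact (n t)) = fact (card V)"
  proof (rule card_covers_with_patterns)
    show "finite I" using I by simp
    show "(\<Sum>t\<in>Pow I - {{}}. n t) = card V"
      using I assms unfolding Pow by (simp add: n_def doubleton_eq_iff)
    fix l assume "l \<in> I"
    then have "{t \<in> Pow I. l \<in> t} = {{l}, {i, j}}" using I by auto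
    moreover have "{l} \<noteq> {i, j}" using I(2) by auto
    ultimately have "(\<Sum>t\<in>{t \<in> Pow I. l \<in> t}. n t) = n {l} + n {i, j}" by simp
    then show "(\<Sum>t\<in>{t \<in> Pow I. l \<in> t}. n t) = k"
      using I(2) assms(1) by (simp add: n_def)
  qed (use assms in simp)
  moreover have "(\<Prod>t\<in>Pow I - {{}}. fact (n t)) = (6 * fact (k - 3) ^ 2 :: nat)"
    using I unfolding Pow by (simp add: n_def doubleton_eq_iff power2_eq_square fact_numeral)
  ultimately have "card (covers k I V) * (6 * fact (k - 3) ^ 2) = fact (card V)" by simp
  then show ?thesis using w assms by (simp add: mult_ac)
qed

section \<open>Three cliques\<close>

text \<open>
  Listing the seven patterns without repetition lets sums and products over them be evaluated.
\<close>

lemma nonempty_patterns_3: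
  assumes "distinct [i, j, l]"
  shows "Pow {i, j, l} - {{}} = set [{i}, {j}, {l}, {i, j}, {i, l}, {j, l}, {i, j, l}]"
    and "distinct [{i}, {j}, {l}, {i, j}, {i, l}, {j, l}, {i, j, l}]"
  using assms by (auto simp: Pow_insert doubleton_eq_iff insert_commute) 

lemma pattern_counts_3:
  assumes V: "finite V" and S: "S \<in> covers k {i, j, l} V" and d: "distinct [i, j, l]"
  defines "x \<equiv> \<lambda>t. card {v \<in> V. pattern {i, j, l} S v = t}"
  shows "k = x {i} + x {i, j} + x {i, l} + x {i, j, l}"
    and "card (S i \<inter> shared {i, j, l} S) = x {i, j} + x {i, l} + x {i, j, l}"
proof -
  let ?I = "{i, j, l}"
  have sub: "S i \<subseteq> V" "card (S i) = k" using coversD[OF S] by auto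
  have ne: "{i} \<noteq> {i, j}" "{i} \<noteq> {i, l}" "{i} \<noteq> {i, j, l}" "{i, j} \<noteq> {i, l}"
    "{i, j} \<noteq> {i, j, l}" "{i, l} \<noteq> {i, j, l}"
    using d by auto
  have "{t \<in> Pow ?I. i \<in> t} = {{i}, {i, j}, {i, l}, ?I}"
    by (auto simp: Pow_insert)
  moreover have "pattern ?I S v \<in> {t \<in> Pow ?I. i \<in> t} \<longleftrightarrow> v \<in> S i" for v
    by (auto simp: pattern_def)
  ultimately have p: "pattern ?I S v \<in> {{i}, {i, j}, {i, l}, ?I} \<longleftrightarrow> v \<in> S i" for v
    by metis
  have "S i = {v \<in> V. pattern ?I S v \<in> {{i}, {i, j}, {i, l}, ?I}}"
    unfolding p using sub by blast
  then have "card (S i) = (\<Sum>t\<in>{{i}, {i, j}, {i, l}, ?I}. x t)"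
    using card_vimage_eq_sum[OF V, of "{{i}, {i, j}, {i, l}, ?I}" "pattern ?I S"] by (simp add: x_def)
  then show "k = x {i} + x {i, j} + x {i, l} + x {i, j, l}" using sub ne by simp
  have "2 \<le> card (pattern ?I S v) \<longleftrightarrow> pattern ?I S v \<in> {{i, j}, {i, l}, ?I}" if "v \<in> S i" for v
  proof -
    have "pattern ?I S v = {i} \<or> pattern ?I S v \<in> {{i, j}, {i, l}, ?I}"
      using iffD2[OF p that] by (simp only: insert_iff)
    then show ?thesis
    proof
      assume eq: "pattern ?I S v = {i}"
      have "{i} \<notin> {{i, j}, {i, l}, ?I}" using ne by blast
      then show ?thesis unfolding eq by simp
    next
      assume eq: "pattern ?I S v \<in> {{i, j}, {i, l}, ?I}"
      have "2 \<le> card {i, j}" "2 \<le> card {i, l}" "2 \<le> card ?I" using d by auto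
      with eq have "2 \<le> card (pattern ?I S v)" by (elim insertE emptyE) (simp_all only:)
      with eq show ?thesis by blast
    qed
  qed
  then have "S i \<inter> shared ?I S = {v \<in> V. pattern ?I S v \<in> {{i, j}, {i, l}, ?I}}"
    using sub p unfolding shared_def card_pattern[symmetric] by blast
  then have "card (S i \<inter> shared ?I S) = (\<Sum>t\<in>{{i, j}, {i, l}, ?I}. x t)"
    using card_vimage_eq_sum[OF V, of "{{i, j}, {i, l}, ?I}" "pattern ?I S"] by (simp add: x_def)
  then show "card (S i \<inter> shared ?I S) = x {i, j} + x {i, l} + x {i, j, l}" using ne by simp
qed

text \<open>
  The partner contains all shared vertices of clique \<open>i\<close>, so clique \<open>i\<close> shares none with the third
  clique.
\<close>

lemma partner_3:
  assumes V: "finite V" and S: "S \<in> covers k {i, j, l} V" and d: "distinct [i, j, l]"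
    and F: "F \<in> cancelling {i, j, l} S"
  defines "x \<equiv> \<lambda>t. card {v \<in> V. pattern {i, j, l} S v = t}"
  assumes three: "card (S i \<inter> shared {i, j, l} S) = 3" and none: "x {i, j, l} = 0"
  shows "x {i, j} = 0 \<or> x {i, l} = 0"
proof -
  let ?I = "{i, j, l}"
  have fin: "finite (S i)" and sub: "S i \<subseteq> V" using coversD[OF S] by auto
  have two: "incidence ?I S v = 2" if v: "v \<in> S i \<inter> shared ?I S" for v
  proof -
    have vV: "v \<in> V" using v sub by blast
    then have "pattern ?I S v \<noteq> ?I" using none V by (auto simp: x_def)
    then have "pattern ?I S v \<subset> ?I" by (auto simp: pattern_def)
    then have "card (pattern ?I S v) < card ?I" by (intro psubset_card_mono) auto
    also have "card ?I = 3" using d by simp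
    finally show ?thesis using v by (simp add: card_pattern shared_def)
  qed
  obtain m where m: "m \<in> ?I" "m \<noteq> i" "S i \<inter> shared ?I S \<subseteq> S m"
    by (rule partner[OF _ F _ fin three two]) simp_all
  have empty: "{v \<in> V. pattern ?I S v = {i, p}} = {}" if "p \<in> ?I" "p \<noteq> i" "p \<noteq> m" for p
  proof (rule ccontr)
    assume "\<not> ?thesis"
    then obtain v where v: "pattern ?I S v = {i, p}" by blast
    then have "card (pattern ?I S v) = 2" using that by simp
    then have "v \<in> shared ?I S" by (simp add: shared_def card_pattern)
    moreover have "v \<in> S i" using v by (auto simp: pattern_def)
    ultimately have "m \<in> pattern ?I S v" using m by (auto simp: pattern_def)
    then show False using v that m by auto
  qed
  from m consider "m = j" | "m = l" by auto
  then show ?thesis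
  proof cases
    case 1
    then have "{v \<in> V. pattern ?I S v = {i, l}} = {}" by (intro empty) (use d in auto)
    then have "x {i, l} = 0" unfolding x_def by (simp only: card.empty)
    then show ?thesis ..
  next
    case 2
    then have "{v \<in> V. pattern ?I S v = {i, j}} = {}" by (intro empty) (use d in auto)
    then have "x {i, j} = 0" unfolding x_def by (simp only: card.empty)
    then show ?thesis ..
  qed
qed

text \<open>
  Let \<open>a\<close>, \<open>b\<close>, \<open>c\<close> count the vertices in exactly two cliques and \<open>z\<close> those in all
  three. The number of covered vertices gives \<open>a + b + c + 2 * z = 5\<close>, and every clique has at least
  three shared vertices. If \<open>z = 2\<close>, some clique has fewer than three; if \<open>z = 0\<close>, partners
  exclude every distribution; so \<open>z = 1\<close>, and then \<open>a = b = c = 1\<close>.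
\<close>

lemma star_patterns:
  assumes k: "3 \<le> k" and V: "finite V" "card V = 3 * k - 5" and S: "S \<in> covers k {i, j, l} V"
    and d: "distinct [i, j, l]" and F: "F \<in> cancelling {i, j, l} S" and t: "t \<in> Pow {i, j, l} - {{}}"
  shows "card {v \<in> V. pattern {i, j, l} S v = t} = (if card t = 1 then k - 3 else 1)"
proof -
  let ?I = "{i, j, l}"
  define x where "x t = card {v \<in> V. pattern ?I S v = t}" for t
  have perm: "{j, i, l} = ?I" "{l, i, j} = ?I" "{j, i} = {i, j}" "{l, i} = {i, l}" "{l, j} = {j, l}"
    by auto
  have Sj: "S \<in> covers k {j, i, l} V" and Sl: "S \<in> covers k {l, i, j} V" unfolding perm by (rule S)+
  have Fj: "F \<in> cancelling {j, i, l} S" and Fl: "F \<in> cancelling {l, i, j} S" unfolding perm by (rule F)+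
  have dj: "distinct [j, i, l]" and dl: "distinct [l, i, j]" using d by auto
  note counts = pattern_counts_3[OF V(1) S d, folded x_def]
    pattern_counts_3[OF V(1) Sj dj, unfolded perm, folded x_def]
    pattern_counts_3[OF V(1) Sl dl, unfolded perm, folded x_def]
  note partners = partner_3[OF V(1) S d F, folded x_def]
    partner_3[OF V(1) Sj dj Fj, unfolded perm, folded x_def]
    partner_3[OF V(1) Sl dl Fl, unfolded perm, folded x_def]
  have ge: "3 \<le> card (S p \<inter> shared ?I S)" if "p \<in> ?I" for p
    using three_shared_vertices[OF _ F that] coversD(2)[OF S that] by simp
  have "card V = (\<Sum>t\<in>Pow ?I - {{}}. x t)"
  proof -
    have "{v \<in> V. pattern ?I S v \<in> Pow ?I - {{}}} = V" using pattern_mem[OF S] by blast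
    then show ?thesis
      using card_vimage_eq_sum[OF V(1), of "Pow ?I - {{}}" "pattern ?I S"] by (simp add: x_def)
  qed
  then have total: "3 * k - 5 = x {i} + x {j} + x {l} + x {i, j} + x {i, l} + x {j, l} + x ?I"
    using nonempty_patterns_3[OF d] V(2) by (simp add: sum.distinct_set_conv_list)
  define a b c z where "a = x {i, j}" and "b = x {i, l}" and "c = x {j, l}" and "z = x ?I"
  note abbrev = a_def[symmetric] b_def[symmetric] c_def[symmetric] z_def[symmetric]
  have excess: "a + b + c + 2 * z = 5"
    using total counts(1,3,5) k unfolding abbrev by linarith
  have lower: "3 \<le> a + b + z" "3 \<le> a + c + z" "3 \<le> b + c + z"
    using ge[of i] ge[of j] ge[of l] counts(2,4,6) unfolding abbrev by simp_all
  have part: "a + b + z = 3 \<Longrightarrow> z = 0 \<Longrightarrow> a = 0 \<or> b = 0"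
    "a + c + z = 3 \<Longrightarrow> z = 0 \<Longrightarrow> a = 0 \<or> c = 0"
    "b + c + z = 3 \<Longrightarrow> z = 0 \<Longrightarrow> b = 0 \<or> c = 0"
    using partners counts(2,4,6) unfolding abbrev by simp_all
  have "z \<le> 2" using excess by simp
  then have "z = 1"
  proof -
    have "z \<noteq> 2" using excess lower by linarith
    moreover have "z \<noteq> 0"
    proof
      assume z: "z = 0"
      then have "a \<noteq> 0" "b \<noteq> 0" "c \<noteq> 0" using excess lower by linarith+
      then have "a + b + z \<noteq> 3" "a + c + z \<noteq> 3" "b + c + z \<noteq> 3" using part z by blast+
      then show False using excess lower z by linarith
    qed
    ultimately show ?thesis using \<open>z \<le> 2\<close> by linarith
  qed
  then have one: "x {i, j} = 1" "x {i, l} = 1" "x {j, l} = 1" "x ?I = 1"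
    using excess lower unfolding a_def b_def c_def z_def by linarith+
  then have "x {i} = k - 3" "x {j} = k - 3" "x {l} = k - 3" using counts(1,3,5) by linarith+
  with one have "x t = (if card t = 1 then k - 3 else 1)"
    using t d unfolding nonempty_patterns_3(1)[OF d] by auto
  then show ?thesis by (simp add: x_def)
qed

lemma even_subset_doubleton:
  assumes "F \<subseteq> {e, f}" "F \<noteq> {}" "even (card F)"
  shows "F = {e, f}"
proof -
  have "F = {e} \<or> F = {f} \<or> F = {e, f}" using assms(1,2) by blast
  then show ?thesis using assms(3) by auto
qed

text \<open>
  Clique \<open>i\<close> meets each of the other two in a single edge at the centre \<open>z\<close>, so the only
  nonempty even choice for \<open>F i\<close> is to take both edges. These choices do cancel, since each of the
  three edges is taken by exactly two cliques.
\<close>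

lemma card_cancelling_star:
  assumes d: "distinct [i, j, l]" and v: "distinct [z, a, b, c]"
    and Int: "S i \<inter> S j = {z, c}" "S i \<inter> S l = {z, b}" "S j \<inter> S l = {z, a}"
  shows "card (cancelling {i, j, l} S) = 1"
proof -
  let ?I = "{i, j, l}"
  define G where "G = (\<lambda>p\<in>?I. if p = i then {{z, c}, {z, b}}
      else if p = j then {{z, c}, {z, a}} else {{z, b}, {z, a}})"
  have G: "G i = {{z, c}, {z, b}}" "G j = {{z, c}, {z, a}}" "G l = {{z, b}, {z, a}}"
    using d by (auto simp: G_def)
  have Int': "S j \<inter> S i = {z, c}" "S l \<inter> S i = {z, b}" "S l \<inter> S j = {z, a}"
    using Int by (simp_all only: Int_commute)
  have force: "F p = {{z, u}, {z, w}}"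
    if F: "F \<in> cancelling ?I S" and p: "p \<in> ?I" "?I - {p} \<subseteq> {q, r}"
      and uw: "S p \<inter> S q = {z, u}" "S p \<inter> S r = {z, w}" "z \<noteq> u" "z \<noteq> w" for F p q r u w
  proof (rule even_subset_doubleton)
    show "F p \<noteq> {}" "even (card (F p))"
      using cancelling_edge_sets[OF F p(1)] by (auto simp: even_edge_sets_def)
    show "F p \<subseteq> {{z, u}, {z, w}}"
    proof
      fix e assume e: "e \<in> F p"
      obtain m where m: "m \<in> ?I" "m \<noteq> p" "e \<in> F m"
        by (rule cancelling_other[OF _ F p(1) e]) simp_all
      have sub: "e \<subseteq> S p \<inter> S m" and c: "card e = 2"
        using cancelling_edgeD[OF F p(1) e] cancelling_edgeD[OF F m(1,3)] by auto
      have "m = q \<or> m = r" using m p(2) by blast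
      then show "e \<in> {{z, u}, {z, w}}"
      proof
        assume "m = q"
        then have "e = {z, u}" using sub c uw by (intro card_subset_eq) auto
        then show ?thesis by simp
      next
        assume "m = r"
        then have "e = {z, w}" using sub c uw by (intro card_subset_eq) auto
        then show ?thesis by simp
      qed
    qed
  qed
  have "F = G" if F: "F \<in> cancelling ?I S" for F
  proof
    fix p
    have "F i = G i"
      unfolding G by (rule force[OF F _ _ Int(1,2)]) (use v in auto)
    moreover have "F j = G j"
      unfolding G by (rule force[OF F _ _ Int'(1) Int(3)]) (use v in auto)
    moreover have "F l = G l"
      unfolding G by (rule force[OF F _ _ Int'(2,3)]) (use v in auto)
    moreover have "F p = G p" if "p \<notin> ?I"
      using F that by (auto simp: cancelling_def PiE_def extensional_def G_def)
    ultimately show "F p = G p" by blast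
  qed
  moreover have "G \<in> cancelling ?I S"
  proof -
    have "G i \<in> even_edge_sets (S i)" "G j \<in> even_edge_sets (S j)" "G l \<in> even_edge_sets (S l)"
      unfolding G even_edge_sets_def using v Int by (auto simp: doubleton_eq_iff)
    moreover have "even (card {p \<in> ?I. e \<in> G p})" for e
    proof -
      have ne: "{z, c} \<noteq> {z, b}" "{z, c} \<noteq> {z, a}" "{z, b} \<noteq> {z, a}"
        using v by (auto simp: doubleton_eq_iff)
      have eq: "{p \<in> ?I. e \<in> G p} = (if e \<in> G i then {i} else {}) \<union>
          (if e \<in> G j then {j} else {}) \<union> (if e \<in> G l then {l} else {})"
        by auto
      consider "e = {z, c}" | "e = {z, b}" | "e = {z, a}" | "e \<notin> {{z, c}, {z, b}, {z, a}}" by blast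
      moreover have "card {j, i} = 2" "card {l, i} = 2" "card {l, j} = 2" using d by auto
      ultimately show ?thesis
        unfolding eq G using d ne ne[symmetric] by cases simp_all
    qed
    moreover have "G \<in> extensional ?I" by (simp add: G_def)
    ultimately show ?thesis unfolding cancelling_def by (auto simp: PiE_def)
  qed
  ultimately have "cancelling ?I S = {G}" by blast
  then show ?thesis by simp
qed

lemma star_patterns_cancelling:
  assumes V: "finite V" and S: "S \<in> covers k {i, j, l} V" and d: "distinct [i, j, l]"
    and one: "\<And>t. t \<in> {{i, j}, {i, l}, {j, l}, {i, j, l}} \<Longrightarrow>
      card {v \<in> V. pattern {i, j, l} S v = t} = 1"
  shows "card (cancelling {i, j, l} S) = 1"
proof -
  let ?I = "{i, j, l}" and ?p = "pattern {i, j, l} S"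
  have ex: "\<exists>u. {v \<in> V. ?p v = t} = {u}" if "t \<in> {{i, j}, {i, l}, {j, l}, ?I}" for t
    using one[OF that] by (rule card_1_singletonE) blast
  obtain z where z: "{v \<in> V. ?p v = ?I} = {z}" using ex[of ?I] by auto
  obtain c where c: "{v \<in> V. ?p v = {i, j}} = {c}" using ex[of "{i, j}"] by auto
  obtain b where b: "{v \<in> V. ?p v = {i, l}} = {b}" using ex[of "{i, l}"] by auto
  obtain a where a: "{v \<in> V. ?p v = {j, l}} = {a}" using ex[of "{j, l}"] by auto
  have pz: "?p z = ?I" "?p c = {i, j}" "?p b = {i, l}" "?p a = {j, l}" using z c b a by blast+
  have "distinct [?I, {j, l}, {i, l}, {i, j}]"
    using nonempty_patterns_3(2)[OF d] by (simp add: eq_commute)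
  then have "distinct (map ?p [z, a, b, c])" by (simp only: list.map pz)
  then have dist: "distinct [z, a, b, c]" by (simp only: distinct_map)
  have sub: "S i \<subseteq> V" "S j \<subseteq> V" "S l \<subseteq> V" using coversD(1)[OF S] by auto
  have "v \<in> S i \<inter> S j \<longleftrightarrow> v \<in> V \<and> (?p v = ?I \<or> ?p v = {i, j})" for v
    using sub d by (auto simp: pattern_def)
  then have ij: "S i \<inter> S j = {v \<in> V. ?p v = ?I} \<union> {v \<in> V. ?p v = {i, j}}" by blast
  have "v \<in> S i \<inter> S l \<longleftrightarrow> v \<in> V \<and> (?p v = ?I \<or> ?p v = {i, l})" for v
    using sub d by (auto simp: pattern_def)
  then have il: "S i \<inter> S l = {v \<in> V. ?p v = ?I} \<union> {v \<in> V. ?p v = {i, l}}" by blast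
  have "v \<in> S j \<inter> S l \<longleftrightarrow> v \<in> V \<and> (?p v = ?I \<or> ?p v = {j, l})" for v
    using sub d by (auto simp: pattern_def)
  then have jl: "S j \<inter> S l = {v \<in> V. ?p v = ?I} \<union> {v \<in> V. ?p v = {j, l}}" by blast
  show ?thesis
    by (rule card_cancelling_star[OF d dist]) (simp_all only: ij il jl z a b c Un_insert_left Un_empty_left)
qed

text \<open>
  By \<open>star_patterns\<close> and \<open>star_patterns_cancelling\<close> the weight is the number of stars, which is a
  multinomial coefficient: four singleton classes and three classes of \<open>k - 3\<close> private vertices.
\<close>

lemma weight_3:
  assumes k: "3 \<le> k" and I: "card I = 3" and V: "finite V" "card V = 3 * k - 5"
  shows "weight k I V * fact (k - 3) ^ 3 = fact (3 * k - 5)"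
proof -
  obtain i j l where ijl: "I = {i, j, l}" and d: "distinct [i, j, l]"
    using I by (auto simp: card_3_iff)
  define n where "n = (\<lambda>t :: 'a set. if card t = 1 then k - 3 else 1)"
  let ?star = "{S \<in> covers k I V. \<forall>t\<in>Pow I - {{}}. card {v \<in> V. pattern I S v = t} = n t}"
  have "weight k I V = (\<Sum>S\<in>?star. card (cancelling I S))"
    unfolding weight_def
  proof (rule sum.mono_neutral_right)
    show "finite (covers k I V)" using V ijl by (intro finite_covers) auto
    show "\<forall>S\<in>covers k I V - ?star. card (cancelling I S) = 0"
    proof
      fix S assume S: "S \<in> covers k I V - ?star"
      have "cancelling I S = {}"
      proof (rule ccontr)
        assume "cancelling I S \<noteq> {}"
        then obtain F where "F \<in> cancelling I S" by blast
        then have "S \<in> ?star" using star_patterns[OF k V _ d, of S F] S unfolding ijl n_def by auto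
        with S show False by blast
      qed
      then show "card (cancelling I S) = 0" by simp
    qed
  qed auto
  also have "\<dots> = (\<Sum>S\<in>?star. 1)"
  proof (intro sum.cong refl)
    fix S assume S: "S \<in> ?star"
    have "card {v \<in> V. pattern I S v = t} = 1" if "t \<in> {{i, j}, {i, l}, {j, l}, I}" for t
    proof -
      have "t \<in> Pow I - {{}}" "card t \<noteq> 1" using that d unfolding ijl by auto
      then show ?thesis using S by (simp add: n_def)
    qed
    then show "card (cancelling I S) = 1"
      using star_patterns_cancelling[OF V(1) _ d, of S k] S unfolding ijl by blast
  qed
  finally have w: "weight k I V = card ?star" by simp
  have "card ?star * (\<Prod>t\<in>Pow I - {{}}. fact (n t)) = fact (card V)"
  proof (rule card_covers_with_patterns)
    show "finite I" using ijl by simp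
    show "(\<Sum>t\<in>Pow I - {{}}. n t) = card V"
      using nonempty_patterns_3[OF d] d V k unfolding ijl
      by (simp add: sum.distinct_set_conv_list n_def)
    fix p assume "p \<in> I"
    then obtain q r where pqr: "I = {p, q, r}" "distinct [p, q, r]"
      using d unfolding ijl by (auto simp: insert_commute)
    have "{t \<in> Pow I. p \<in> t} = {{p}, {p, q}, {p, r}, I}" unfolding pqr by (auto simp: Pow_insert)
    moreover have "{p} \<noteq> {p, q}" "{p} \<noteq> {p, r}" "{p} \<noteq> I" "{p, q} \<noteq> {p, r}" "{p, q} \<noteq> I" "{p, r} \<noteq> I"
      using pqr by auto
    ultimately have "(\<Sum>t\<in>{t \<in> Pow I. p \<in> t}. n t) = n {p} + n {p, q} + n {p, r} + n I" by simp
    then show "(\<Sum>t\<in>{t \<in> Pow I. p \<in> t}. n t) = k" using pqr(2) I k by (simp add: n_def)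
  qed (rule V(1))
  moreover have "(\<Prod>t\<in>Pow I - {{}}. fact (n t)) = (fact (k - 3) ^ 3 :: nat)"
    using nonempty_patterns_3[OF d] d unfolding ijl
    by (simp add: prod.distinct_set_conv_list n_def power3_eq_cube)
  ultimately show ?thesis using w V by simp
qed

section \<open>Four and five cliques\<close>

text \<open>
  Uniqueness of the pair in \<open>Ps\<close> lets the weight be summed over the pair first. The constants
  \<open>c1\<close> and \<open>c2\<close> express weights relative to factorials, the scale on which they are multiplicative,
  because the binomial coefficient for choosing the vertices of the pair is absorbed.
\<close>

lemma weight_by_detached_pairs:
  assumes I: "finite I" and V: "finite V" "d \<le> card V" and Ps: "Ps \<subseteq> nsets I 2"
    and unique: "\<And>S F. S \<in> covers k I V \<Longrightarrow> F \<in> cancelling I S \<Longrightarrow>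
      \<exists>!P. P \<in> Ps \<and> detached I S P \<and> card (\<Union>i\<in>P. S i) = d"
    and w1: "\<And>P A. P \<in> Ps \<Longrightarrow> A \<in> nsets V d \<Longrightarrow> weight k P A * c1 = fact d"
    and w2: "\<And>P A. P \<in> Ps \<Longrightarrow> A \<in> nsets V d \<Longrightarrow> weight k (I - P) (V - A) * c2 = fact (card V - d)"
  shows "weight k I V * (c1 * c2) = card Ps * fact (card V)"
proof -
  let ?good = "\<lambda>S P. detached I S P \<and> card (\<Union>i\<in>P. S i) = d"
  let ?N = "\<lambda>S. card (cancelling I S)"
  have finPs: "finite Ps" using Ps finite_imp_finite_nsets[OF I] by (rule finite_subset)
  have single: "?N S = (\<Sum>P\<in>Ps. if ?good S P then ?N S else 0)" if S: "S \<in> covers k I V" for S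
  proof (cases "cancelling I S = {}")
    case True
    show ?thesis unfolding True card.empty if_cancel by simp
  next
    case False
    then obtain F where "F \<in> cancelling I S" by blast
    from unique[OF S this] obtain P where P: "P \<in> Ps" "?good S P"
      and only: "\<And>Q. Q \<in> Ps \<Longrightarrow> ?good S Q \<Longrightarrow> Q = P" by blast
    have "(\<Sum>Q\<in>Ps. if ?good S Q then ?N S else 0) = (\<Sum>Q\<in>Ps. if Q = P then ?N S else 0)"
      using P only by (intro sum.cong refl) metis
    then show ?thesis using P finPs by simp
  qed
  have "weight k I V = (\<Sum>S\<in>covers k I V. \<Sum>P\<in>Ps. if ?good S P then ?N S else 0)"
    unfolding weight_def by (intro sum.cong refl single)
  also have "\<dots> = (\<Sum>P\<in>Ps. \<Sum>S\<in>covers k I V. if ?good S P then ?N S else 0)"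
    by (rule sum.swap)
  also have "\<dots> = (\<Sum>P\<in>Ps. \<Sum>A\<in>nsets V d. weight k P A * weight k (I - P) (V - A))"
  proof (intro sum.cong refl)
    fix P assume "P \<in> Ps"
    then have "P \<subseteq> I" using Ps by (auto simp: nsets_def)
    then show "(\<Sum>S\<in>covers k I V. if ?good S P then ?N S else 0)
        = (\<Sum>A\<in>nsets V d. weight k P A * weight k (I - P) (V - A))"
      using sum_detached[OF I V(1), of P k d] finite_covers[OF I V(1), of k]
      by (simp add: sum.inter_filter)
  qed
  finally have "weight k I V * (c1 * c2) =
      (\<Sum>P\<in>Ps. \<Sum>A\<in>nsets V d. weight k P A * weight k (I - P) (V - A) * (c1 * c2))"
    by (simp only: sum_distrib_right)
  also have "\<dots> = (\<Sum>P\<in>Ps. \<Sum>A\<in>nsets V d. (weight k P A * c1) * (weight k (I - P) (V - A) * c2))"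
    by (intro sum.cong refl) (simp only: mult_ac)
  also have "\<dots> = (\<Sum>P\<in>Ps. \<Sum>A\<in>nsets V d. fact d * fact (card V - d))"
    by (intro sum.cong refl) (simp add: w1 w2)
  also have "\<dots> = card Ps * ((card V choose d) * (fact d * fact (card V - d)))"
    by (simp add: card_nsets)
  also have "(card V choose d) * (fact d * fact (card V - d)) = fact (card V)"
    using binomial_fact_lemma[OF V(2)] by (simp add: mult_ac)
  finally show ?thesis .
qed

text \<open>
  The two cliques in \<open>P\<close> share vertices, so a detached pair containing one of them contains both.
\<close>

lemma detached_pairs_eq:
  assumes k: "3 \<le> k" and S: "S \<in> covers k I V" and P: "P \<in> nsets I 2" "Q \<in> nsets I 2"
    and card: "card (\<Union>i\<in>P. S i) = 2 * k - 3" and det: "detached I S Q" and meet: "P \<inter> Q \<noteq> {}"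
  shows "P = Q"
proof -
  obtain i where i: "i \<in> P" "i \<in> Q" using meet by blast
  obtain j where j: "P = {i, j}" "i \<noteq> j"
    using P(1) i(1) by (auto simp: nsets_def card_2_iff)
  have ij: "i \<in> I" "j \<in> I" using P(1) j by (auto simp: nsets_def)
  have "j \<in> Q"
  proof (rule ccontr)
    assume "j \<notin> Q"
    then have "S i \<inter> S j = {}" using det i ij unfolding detached_def by blast
    then have "card (S i \<union> S j) = 2 * k"
      using card_Un_disjoint[of "S i" "S j"] coversD[OF S ij(1)] coversD[OF S ij(2)] by simp
    then show False using card j k by simp
  qed
  then have "P \<subseteq> Q" using i j by simp
  then show ?thesis using P by (intro card_subset_eq) (auto simp: nsets_def)
qed

lemma zero_excess:
  assumes I: "finite I" "finite V" and S: "S \<in> covers k I V" and F: "F \<in> cancelling I S"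
  shows "(\<Sum>i\<in>I. card (S i \<inter> shared I S) - 3) = 0 \<Longrightarrow> i \<in> I \<Longrightarrow> card (S i \<inter> shared I S) = 3"
    and "(\<Sum>v\<in>shared I S. incidence I S v - 2) = 0 \<Longrightarrow> v \<in> shared I S \<Longrightarrow> incidence I S v = 2"
proof -
  have "finite (shared I S)" using shared_subset[OF S] I(2) by (rule finite_subset)
  then show "incidence I S v = 2"
    if "(\<Sum>v\<in>shared I S. incidence I S v - 2) = 0" "v \<in> shared I S"
    using that by (auto simp: shared_def)
  show "card (S i \<inter> shared I S) = 3"
    if "(\<Sum>i\<in>I. card (S i \<inter> shared I S) - 3) = 0" "i \<in> I"
    using that three_shared_vertices[OF I(1) F that(2)] coversD(2)[OF S that(2)] I(1) by auto
qed

text \<open>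
  There is no surplus, so any fixed clique \<open>a\<close> has a partner and splits off with it. Only pairs
  containing \<open>a\<close> are used, since otherwise each tuple would be counted by both of its pairs.
\<close>

lemma weight_4:
  assumes k: "3 \<le> k" and I: "card I = 4" and V: "finite V" "card V = 4 * k - 6"
  shows "weight k I V * (4 * fact (k - 3) ^ 4) = 3 * fact (4 * k - 6)"
proof -
  have fin: "finite I" using I by (simp add: card_ge_0_finite)
  obtain a where a: "a \<in> I" using I by fastforce
  define Ps where "Ps = (\<lambda>j. {a, j}) ` (I - {a})"
  have Ps: "Ps \<subseteq> nsets I 2" using a by (auto simp: Ps_def)
  have aPs: "a \<in> P" if "P \<in> Ps" for P using that by (auto simp: Ps_def)
  have "inj_on (\<lambda>j. {a, j}) (I - {a})" by (auto simp: inj_on_def doubleton_eq_iff)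
  then have cPs: "card Ps = 3" using I a by (simp add: Ps_def card_image)
  \<comment> \<open>Both the pair and its complement contribute the constant of two cliques.\<close>
  have "weight k I V * ((2 * fact (k - 3) ^ 2) * (2 * fact (k - 3) ^ 2)) = card Ps * fact (card V)"
  proof (rule weight_by_detached_pairs[where d = "2 * k - 3" and Ps = Ps])
    fix S F assume S: "S \<in> covers k I V" and F: "F \<in> cancelling I S"
    have "cancelling I S \<noteq> {}" using F by blast
    note ex = excess_identity[OF fin V(1) S this]
    have "(\<Sum>i\<in>I. card (S i \<inter> shared I S) - 3) + (\<Sum>v\<in>shared I S. incidence I S v - 2) = 0"
      using ex k unfolding I V(2) by linarith
    then have "(\<Sum>i\<in>I. card (S i \<inter> shared I S) - 3) = 0" "(\<Sum>v\<in>shared I S. incidence I S v - 2) = 0"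
      by (simp_all only: add_is_0)
    note z = zero_excess(1)[OF fin V(1) S F this(1)] zero_excess(2)[OF fin V(1) S F this(2)]
    obtain j where j: "j \<in> I" "j \<noteq> a" "S a \<inter> shared I S \<subseteq> S j"
      by (rule partner[OF fin F a coversD(2)[OF S a] z(1)[OF a]]) (auto simp: z(2))
    have "detached I S {a, j}" "card (\<Union>l\<in>{a, j}. S l) = 2 * k - 3"
      by (rule partners_detached[OF fin S a j(1) j(2)[symmetric] z(1)[OF a] z(1)[OF j(1)] _ j(3)];
          simp add: z(2))+
    moreover have "{a, j} \<in> Ps" using j by (simp add: Ps_def)
    moreover have "P = Q" if "P \<in> Ps" "Q \<in> Ps" "card (\<Union>i\<in>P. S i) = 2 * k - 3" "detached I S Q" for P Q
      using detached_pairs_eq[OF k S, of P Q] that Ps aPs by blast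
    ultimately show "\<exists>!P. P \<in> Ps \<and> detached I S P \<and> card (\<Union>i\<in>P. S i) = 2 * k - 3"
      by (intro ex1I[of _ "{a, j}"]) auto
  next
    fix P A assume P: "P \<in> Ps" and A: "A \<in> nsets V (2 * k - 3)"
    have cP: "P \<subseteq> I" "finite P" "card P = 2" using P Ps by (auto simp: nsets_def)
    have cA: "A \<subseteq> V" "finite A" "card A = 2 * k - 3" using A by (auto simp: nsets_def)
    show "weight k P A * (2 * fact (k - 3) ^ 2) = fact (2 * k - 3)"
      by (rule weight_2[OF k cP(3) cA(2,3)])
    have d: "card V - (2 * k - 3) = 2 * k - 3" using V(2) k by linarith
    have "card (I - P) = 2" using card_Diff_subset[OF cP(2,1)] cP I by simp
    moreover have "card (V - A) = 2 * k - 3" using card_Diff_subset[OF cA(2,1)] cA d by simp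
    ultimately show "weight k (I - P) (V - A) * (2 * fact (k - 3) ^ 2) = fact (card V - (2 * k - 3))"
      unfolding d using V(1) by (intro weight_2[OF k]) auto
  qed (use fin V Ps k in auto)
  moreover have "(2 * fact (k - 3) ^ 2) * (2 * fact (k - 3) ^ 2) = (4 * fact (k - 3) ^ 4 :: nat)"
    by (simp add: power_add[symmetric] mult_ac)
  ultimately show ?thesis using cPs V(2) by simp
qed

text \<open>
  The surplus is one. If it is a vertex in three cliques, a clique avoiding this vertex has a
  partner without surplus. If it is a clique \<open>p\<close> with four shared vertices, then of two other
  cliques at most one can have \<open>p\<close> as its partner, because the two triples would be disjoint
  subsets of the four shared vertices of \<open>p\<close>; the other one has a partner without surplus.
\<close>

lemma exists_detached_pair_5:
  assumes k: "3 \<le> k" and I: "card I = 5" and V: "finite V" "card V = 5 * k - 8"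
    and S: "S \<in> covers k I V" and F: "F \<in> cancelling I S"
  shows "\<exists>P\<in>nsets I 2. detached I S P \<and> card (\<Union>i\<in>P. S i) = 2 * k - 3"
proof -
  let ?U = "shared I S" and ?m = "incidence I S"
  have fin: "finite I" using I by (simp add: card_ge_0_finite)
  have finU: "finite ?U" using shared_subset[OF S] V(1) by (rule finite_subset)
  have pair: ?thesis
    if ij: "i \<in> I" "j \<in> I" "i \<noteq> j" and c: "card (S i \<inter> ?U) = 3" "card (S j \<inter> ?U) = 3"
      and two: "\<And>v. v \<in> S i \<inter> ?U \<Longrightarrow> ?m v = 2" and sub: "S i \<inter> ?U \<subseteq> S j" for i j
  proof (intro bexI[of _ "{i, j}"] conjI)
    show "{i, j} \<in> nsets I 2" using ij by simp
    show "detached I S {i, j}" "card (\<Union>l\<in>{i, j}. S l) = 2 * k - 3"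
      by (rule partners_detached[OF fin S ij c two sub]; assumption)+
  qed
  have "cancelling I S \<noteq> {}" using F by blast
  note ex = excess_identity[OF fin V(1) S this]
  have "(\<Sum>i\<in>I. card (S i \<inter> ?U) - 3) + (\<Sum>v\<in>?U. ?m v - 2) = 1"
    using ex k unfolding I V(2) by linarith
  then consider "(\<Sum>i\<in>I. card (S i \<inter> ?U) - 3) = 0" "(\<Sum>v\<in>?U. ?m v - 2) = 1"
    | "(\<Sum>i\<in>I. card (S i \<inter> ?U) - 3) = 1" "(\<Sum>v\<in>?U. ?m v - 2) = 0"
    by linarith
  then show ?thesis
  proof cases
    case 1
    note three = zero_excess(1)[OF fin V(1) S F 1(1)]
    obtain z where z: "z \<in> ?U" "?m z - 2 = 1" and other: "\<And>v. v \<in> ?U \<Longrightarrow> v \<noteq> z \<Longrightarrow> ?m v - 2 = 0"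
      using 1(2) sum_eq_1_iff[OF finU, of "\<lambda>v. ?m v - 2"] by metis
    have "\<not> I \<subseteq> {i \<in> I. z \<in> S i}"
    proof
      assume "I \<subseteq> {i \<in> I. z \<in> S i}"
      then have "{i \<in> I. z \<in> S i} = I" by blast
      then show False using z I by (simp add: incidence_def)
    qed
    then obtain i where i: "i \<in> I" "z \<notin> S i" by blast
    have two: "?m v = 2" if "v \<in> S i \<inter> ?U" for v
    proof -
      have "v \<noteq> z" using that i by blast
      then show ?thesis using other[of v] that by (auto simp: shared_def)
    qed
    obtain j where j: "j \<in> I" "j \<noteq> i" "S i \<inter> ?U \<subseteq> S j"
      by (rule partner[OF fin F i(1) coversD(2)[OF S i(1)] three[OF i(1)] two])
    show ?thesis
      by (rule pair[OF i(1) j(1) j(2)[symmetric] three[OF i(1)] three[OF j(1)] two j(3)])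
  next
    case 2
    note two = zero_excess(2)[OF fin V(1) S F 2(2)]
    obtain p where p: "p \<in> I" "card (S p \<inter> ?U) - 3 = 1"
      and other: "\<And>i. i \<in> I \<Longrightarrow> i \<noteq> p \<Longrightarrow> card (S i \<inter> ?U) - 3 = 0"
      using 2(1) sum_eq_1_iff[OF fin, of "\<lambda>i. card (S i \<inter> ?U) - 3"] by metis
    have three: "card (S i \<inter> ?U) = 3" if "i \<in> I" "i \<noteq> p" for i
      using other[OF that] three_shared_vertices[OF fin F that(1) coversD(2)[OF S that(1)]] by simp
    have ex_partner: "\<exists>j\<in>I. j \<noteq> i \<and> S i \<inter> ?U \<subseteq> S j" if i: "i \<in> I" "i \<noteq> p" for i
      by (rule partner[OF fin F i(1) coversD(2)[OF S i(1)] three[OF i]]) (auto simp: two)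
    have "2 \<le> card (I - {p})" using I p(1) by simp
    then obtain i l where il: "i \<in> I" "i \<noteq> p" "l \<in> I" "l \<noteq> p" "i \<noteq> l"
      by (auto simp: numeral_2_eq_2 card_le_Suc_iff)
    have "\<not> (S i \<inter> ?U \<subseteq> S p \<and> S l \<inter> ?U \<subseteq> S p)"
    proof
      let ?A = "S i \<inter> ?U" and ?B = "S l \<inter> ?U"
      assume sub: "?A \<subseteq> S p \<and> ?B \<subseteq> S p"
      have f: "finite ?A" "finite ?B" "finite (S p \<inter> ?U)" using finU by auto
      have "?A \<inter> ?B = {}"
      proof (rule ccontr)
        assume "?A \<inter> ?B \<noteq> {}"
        then obtain v where v: "v \<in> S i" "v \<in> S l" "v \<in> ?U" "v \<in> S p" using sub by blast
        then have "?m v \<le> 2" using two by simp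
        then show False
          using incidence_le_2_cases[OF fin, of S v i l p] v il p(1) by auto
      qed
      then have "card (?A \<union> ?B) = 6" using card_Un_disjoint[OF f(1,2)] three il by simp
      moreover have "card (?A \<union> ?B) \<le> card (S p \<inter> ?U)" using f(3) sub by (intro card_mono) auto
      ultimately show False using p(2) by simp
    qed
    then obtain q where q: "q \<in> I" "q \<noteq> p" "\<not> S q \<inter> ?U \<subseteq> S p" using il by blast
    obtain j where j: "j \<in> I" "j \<noteq> q" "S q \<inter> ?U \<subseteq> S j" using ex_partner[OF q(1,2)] by blast
    then have "j \<noteq> p" using q(3) by blast
    show ?thesis
      by (rule pair[OF q(1) j(1) j(2)[symmetric] three[OF q(1,2)] three[OF j(1) \<open>j \<noteq> p\<close>] _ j(3)])
         (simp add: two)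
  qed
qed

text \<open>
  Two disjoint detached pairs cannot coexist: they would leave a single clique without any shared
  vertex. So the detached pair is unique among all pairs, and the three other cliques form a star.
\<close>

lemma weight_5:
  assumes k: "3 \<le> k" and I: "card I = 5" and V: "finite V" "card V = 5 * k - 8"
  shows "weight k I V * (2 * fact (k - 3) ^ 5) = 10 * fact (5 * k - 8)"
proof -
  have fin: "finite I" using I by (simp add: card_ge_0_finite)
  have "weight k I V * ((2 * fact (k - 3) ^ 2) * fact (k - 3) ^ 3) = card (nsets I 2) * fact (card V)"
  proof (rule weight_by_detached_pairs[where d = "2 * k - 3" and Ps = "nsets I 2"])
    fix S F assume S: "S \<in> covers k I V" and F: "F \<in> cancelling I S"
    obtain P where P: "P \<in> nsets I 2" "detached I S P" "card (\<Union>i\<in>P. S i) = 2 * k - 3"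
      using exists_detached_pair_5[OF k I V S F] by blast
    have unique: "Q = P" if Q: "Q \<in> nsets I 2" "detached I S Q" "card (\<Union>i\<in>Q. S i) = 2 * k - 3" for Q
    proof (rule detached_pairs_eq[OF k S Q(1) P(1) Q(3) P(2)], rule notI)
      assume disj: "Q \<inter> P = {}"
      have c: "P \<subseteq> I" "Q \<subseteq> I" "card P = 2" "card Q = 2" "finite P" "finite Q"
        using P(1) Q(1) by (auto simp: nsets_def)
      have "card (Q \<union> P) = 4" using card_Un_disjoint[of Q P] c disj by simp
      then have "card (I - (Q \<union> P)) = 1" using card_Diff_subset[of "Q \<union> P" I] c I by simp
      then obtain l where l: "I - (Q \<union> P) = {l}" by (rule card_1_singletonE)
      have "S l \<inter> shared I S = {}"
      proof (rule ccontr)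
        assume "S l \<inter> shared I S \<noteq> {}"
        then obtain v where v: "v \<in> S l" "v \<in> shared I S" by blast
        have "\<not> {i \<in> I. v \<in> S i} \<subseteq> {l}"
        proof
          assume "{i \<in> I. v \<in> S i} \<subseteq> {l}"
          from card_mono[OF _ this] show False using v(2) by (simp add: shared_def incidence_def)
        qed
        then obtain j where j: "j \<in> I" "v \<in> S j" "j \<noteq> l" by blast
        then have "j \<in> P \<or> j \<in> Q" using l by blast
        moreover have "l \<in> I - P" "l \<in> I - Q" using l by blast+
        ultimately show False using P(2) Q(2) v(1) j(2) unfolding detached_def by blast
      qed
      moreover have "l \<in> I" using l by blast
      ultimately show False using three_shared_vertices[OF fin F _ coversD(2)[OF S], of l] by simp
    qed
    show "\<exists>!P. P \<in> nsets I 2 \<and> detached I S P \<and> card (\<Union>i\<in>P. S i) = 2 * k - 3"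
    proof (rule ex1I[of _ P])
      show "P \<in> nsets I 2 \<and> detached I S P \<and> card (\<Union>i\<in>P. S i) = 2 * k - 3"
        using P by (intro conjI)
    qed (use unique in blast)
  next
    fix P A assume P: "P \<in> nsets I 2" and A: "A \<in> nsets V (2 * k - 3)"
    have cP: "P \<subseteq> I" "finite P" "card P = 2" using P by (auto simp: nsets_def)
    have cA: "A \<subseteq> V" "finite A" "card A = 2 * k - 3" using A by (auto simp: nsets_def)
    show "weight k P A * (2 * fact (k - 3) ^ 2) = fact (2 * k - 3)"
      by (rule weight_2[OF k cP(3) cA(2,3)])
    have d: "card V - (2 * k - 3) = 3 * k - 5" using V(2) k by linarith
    have "card (I - P) = 3" using card_Diff_subset[OF cP(2,1)] cP I by simp
    moreover have "card (V - A) = 3 * k - 5" using card_Diff_subset[OF cA(2,1)] cA d by simp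
    ultimately show "weight k (I - P) (V - A) * fact (k - 3) ^ 3 = fact (card V - (2 * k - 3))"
      unfolding d using V(1) by (intro weight_3[OF k]) auto
  qed (use fin V k in auto)
  moreover have "(2 * fact (k - 3) ^ 2) * fact (k - 3) ^ 3 = (2 * fact (k - 3) ^ 5 :: nat)"
    by (simp add: power_add[symmetric] mult_ac)
  moreover have "card (nsets I 2) = 10" using I by (simp add: card_nsets choose_two)
  ultimately show ?thesis using V(2) by simp
qed

section \<open>Leading terms\<close>

text \<open>
  The bound on \<open>d\<close> says that the surplus would be negative for any larger vertex set.
\<close>

lemma leading_term_from_weight:
  assumes k: "3 \<le> k" and d: "2 * k * r < 3 * r + 2 * d + 2"
    and w: "weight k {..<r} {1..d} * c = b * fact d" and pos: "b \<noteq> 0" "c \<noteq> 0"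
  shows "has_leading_term (central_moment r k)
           (real b / real c * (1 / 2 ^ (r * (k choose 2) - r))) d"
proof -
  have pos_w: "weight k {..<r} {1..d} \<noteq> 0" using w pos by (cases "weight k {..<r} {1..d} = 0") auto
  have "real (weight k {..<r} {1..d}) * real c = real b * fact d"
    using arg_cong[OF w, of real] by simp
  then have weight: "real (weight k {..<r} {1..d}) / fact d = real b / real c"
    using pos by (simp add: field_simps)
  have "0 < k choose 2" using k by (intro zero_less_binomial) simp
  then have "r * 1 \<le> r * (k choose 2)" by (intro mult_le_mono2) linarith
  then have "(2::real) ^ (r * (k choose 2)) = 2 ^ r * 2 ^ (r * (k choose 2) - r)"
    unfolding power_add[symmetric] by simp
  then have const: "(2 / 2 ^ (k choose 2)) ^ r = 1 / (2 :: real) ^ (r * (k choose 2) - r)"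
    by (simp add: power_divide power_mult[symmetric] mult.commute)
  have "has_leading_term (central_moment r k)
      ((2 / 2 ^ (k choose 2)) ^ r * (real (weight k {..<r} {1..d}) / fact d)) d"
  proof (rule has_leading_term_central_moment)
    fix v assume "d < v"
    then show "weight k {..<r} {1..v} = 0" using d by (intro weight_eq_0) auto
  qed (use k pos_w in auto)
  then show ?thesis unfolding weight const by (simp add: mult.commute)
qed

theorem theorem2:
  fixes k :: nat
  assumes "k \<ge> 3"
  shows "has_leading_term (central_moment 2 k)
           (1 / 2 * (1 / (fact (k - 3)) ^ 2) * (1 / 2 ^ (2 * (k choose 2) - 2))) (2 * k - 3)
    \<and> has_leading_term (central_moment 3 k)
           (1 / (fact (k - 3)) ^ 3 * (1 / 2 ^ (3 * (k choose 2) - 3))) (3 * k - 5)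
    \<and> has_leading_term (central_moment 4 k)
           (3 / 4 * (1 / (fact (k - 3)) ^ 4) * (1 / 2 ^ (4 * (k choose 2) - 4))) (4 * k - 6)
    \<and> has_leading_term (central_moment 5 k)
           (5 * (1 / (fact (k - 3)) ^ 5) * (1 / 2 ^ (5 * (k choose 2) - 5))) (5 * k - 8)"
proof -
  let ?f = "fact (k - 3) :: nat"
  have "weight k {..<2::nat} {1..2 * k - 3} * (2 * ?f ^ 2) = 1 * fact (2 * k - 3)"
    using weight_2[OF assms, of "{..<2::nat}" "{1..2 * k - 3}"] by simp
  from leading_term_from_weight[OF assms _ this] assms
  have 2: "has_leading_term (central_moment 2 k)
      (real 1 / real (2 * ?f ^ 2) * (1 / 2 ^ (2 * (k choose 2) - 2))) (2 * k - 3)"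
    by simp
  have "weight k {..<3::nat} {1..3 * k - 5} * ?f ^ 3 = 1 * fact (3 * k - 5)"
    using weight_3[OF assms, of "{..<3::nat}" "{1..3 * k - 5}"] by simp
  from leading_term_from_weight[OF assms _ this] assms
  have 3: "has_leading_term (central_moment 3 k)
      (real 1 / real (?f ^ 3) * (1 / 2 ^ (3 * (k choose 2) - 3))) (3 * k - 5)"
    by simp
  have "weight k {..<4::nat} {1..4 * k - 6} * (4 * ?f ^ 4) = 3 * fact (4 * k - 6)"
    using weight_4[OF assms, of "{..<4::nat}" "{1..4 * k - 6}"] by simp
  from leading_term_from_weight[OF assms _ this] assms
  have 4: "has_leading_term (central_moment 4 k)
      (real 3 / real (4 * ?f ^ 4) * (1 / 2 ^ (4 * (k choose 2) - 4))) (4 * k - 6)"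
    by simp
  have "weight k {..<5::nat} {1..5 * k - 8} * (2 * ?f ^ 5) = 10 * fact (5 * k - 8)"
    using weight_5[OF assms, of "{..<5::nat}" "{1..5 * k - 8}"] by simp
  from leading_term_from_weight[OF assms _ this] assms
  have 5: "has_leading_term (central_moment 5 k)
      (real 10 / real (2 * ?f ^ 5) * (1 / 2 ^ (5 * (k choose 2) - 5))) (5 * k - 8)"
    by simp
  show ?thesis using 2 3 4 5 by (simp add: power_one_over)
qed

end
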